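(* Let $p \in [1,\infty]$ and $B > 0$. Let $X \subset \mathbb{R}$ be a uniformly discrete set with $\mathrm{l.u.d.}(X) > 4B$ and let $\Omega \subset \mathbb{R}$ be a countable set such that $\sum_{\omega \in \Omega \setminus \{0\}} |\omega|^{-1}$ diverges. Then, for all $f,g \in \mathrm{PW}_B^p$, the following are equivalent: 1. $f = \mathrm{e}^{\mathrm{i}\alpha} g$ for some $\alpha \in \mathbb{R}$; 2. $|\mathcal{G} f(x,\omega)| = |\mathcal{G} g(x,\omega)|$ for all $(x,\omega) \in X \times \Omega$.
   Context: Functions are complex-valued. The Fourier transform is $\mathcal{F} f(\xi) = \int_{\mathbb{R}} f(t) \mathrm{e}^{-2\pi \mathrm{i} t\xi}\,\mathrm{d}t$ on the Schwartz space $\mathcal{S}(\mathbb{R})$, extended to the tempered distributions $\mathcal{S}'(\mathbb{R})$. $L^p([-B,B])$ is regarded as the space of $L^p(\mathbb{R})$ functions vanishing outside $[-B,B]$. The Paley--Wiener space is, for $B>0$ and $p\in[1,\infty]$, $$\mathrm{PW}_B^p := \{ f \in \mathcal{S}'(\mathbb{R}) : f = \mathcal{F}F \text{ for some } F \in L^p([-B,B]) \}.$$ Its elements are (bounded, continuous) functions, belonging to $L^2(\mathbb{R})$ if $p \geq 2$ and to $L^{q}(\mathbb{R})$ with $q$ the Hölder conjugate of $p$ if $p \leq 2$. For $f \in L^r(\mathbb{R})$, $r \in [1,\infty]$, the Gabor transform is $$\mathcal{G} f (x,\omega) := 2^{1/4} \int_{\mathbb{R}} f(t)\, \mathrm{e}^{-\pi(t-x)^2}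 \mathrm{e}^{-2\pi \mathrm{i} t \omega}\, \mathrm{d}t, \qquad (x,\omega) \in \mathbb{R}^2.$$ A set $X \subset \mathbb{R}$ is uniformly discrete if there exists $\epsilon > 0$ such that $|x-y| > \epsilon$ for all $x,y\in X$ with $x \neq y$. With $\underline{n}(r) := \inf_{t \in \mathbb{R}} |X \cap [t,t+r]|$ for $r>0$ (where $|\cdot|$ denotes cardinality), the lower uniform density of $X$ is $\mathrm{l.u.d.}(X) := \lim_{r\to\infty} \underline{n}(r)/r$. *)

theory Defs
  imports "HOL-Analysis.Analysis"
begin

definition fourier :: "(real \<Rightarrow> complex) \<Rightarrow> real \<Rightarrow> complex" where
  "fourier f \<xi> = (LINT t|lborel. f t * exp (- 2 * complex_of_real pi * \<i> * of_real t * of_real \<xi>))"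

(* D n is the n-th derivative of \<phi>. *)
definition schwartz :: "(real \<Rightarrow> complex) set" where
  "schwartz = {\<phi>. \<exists>D :: nat \<Rightarrow> real \<Rightarrow> complex.
      D 0 = \<phi> \<and>
      (\<forall>n x. (D n has_vector_derivative D (Suc n) x) (at x)) \<and>
      (\<forall>m n. bounded (range (\<lambda>x. x ^ m *\<^sub>R D n x)))}"

(* Distributions are represented by functionals on all functions; only their values on Schwartz
   functions are meaningful, so they are only ever compared on the set schwartz. *)
definition regular_distr :: "(real \<Rightarrow> complex) \<Rightarrow> (real \<Rightarrow> complex) \<Rightarrow> complex" where
  "regular_distr f \<phi> = (LINT t|lborel. f t * \<phi> t)"

definition distr_fourier ::
    "((real \<Rightarrow> complex) \<Rightarrow> complex) \<Rightarrow> (real \<Rightarrow> complex) \<Rightarrow> complex" where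
  "distr_fourier T \<phi> = T (fourier \<phi>)"

definition Lp_interval :: "ennreal \<Rightarrow> real \<Rightarrow> (real \<Rightarrow> complex) set" where
  "Lp_interval p B = {F. F \<in> borel_measurable lborel \<and>
      (\<forall>t. t \<notin> {-B..B} \<longrightarrow> F t = 0) \<and>
      (if p = \<infinity> then \<exists>C. AE t in lborel. cmod (F t) \<le> C
       else integrable lborel (\<lambda>t. cmod (F t) powr enn2real p))}"

(* The elements of PW_B^p are tempered distributions given by bounded continuous functions; each is
   identified with its unique continuous representative. Hence f below is a function, and the
   defining identity f = \<F> F is an identity in S'(R). *)
definition PW :: "ennreal \<Rightarrow> real \<Rightarrow> (real \<Rightarrow> complex) set" where
  "PW p B = {f. continuous_on UNIV f \<and> bounded (range f) \<and>
      (\<exists>F \<in> Lp_interval p B. \<forall>\<phi> \<in> schwartz.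
         regular_distr f \<phi> = distr_fourier (regular_distr F) \<phi>)}"

definition gabor :: "(real \<Rightarrow> complex) \<Rightarrow> real \<Rightarrow> real \<Rightarrow> complex" where
  "gabor f x \<omega> = of_real (2 powr (1/4)) *
     (LINT t|lborel. f t * of_real (exp (- pi * (t - x)\<^sup>2)) *
        exp (- 2 * complex_of_real pi * \<i> * of_real t * of_real \<omega>))"

(* The functions below are meant for uniformly discrete X, for which X \<inter> {t..t+r} is always finite
   (card would be 0 on infinite sets) and the limit exists and is finite. *)
definition min_count :: "real set \<Rightarrow> real \<Rightarrow> nat" where
  "min_count X r = (INF t::real. card (X \<inter> {t..t + r}))"

definition lower_uniform_density :: "real set \<Rightarrow> real" where
  "lower_uniform_density X = Lim at_top (\<lambda>r. real (min_count X r) / r)"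

end

theory Submission
  imports Defs "HOL-Probability.Probability" "HOL-Complex_Analysis.Complex_Analysis"
    "HOL-Real_Asymp.Real_Asymp" "HOL-Library.Periodic_Fun"
begin

text \<open>
  Multiplication by a unimodular constant leaves all Gabor magnitudes unchanged, so the content is the
  converse. It is a statement about zeros of entire functions.

  Let \<open>F\<close> and \<open>G\<close> be the spectra of \<open>f\<close> and \<open>g\<close>, supported in \<open>[-B, B]\<close>. As \<open>p \<ge> 1\<close>, they are integrable.
  Pairing with a Gaussian wave packet expresses \<open>|gabor f x \<omega>|\<close> as a positive factor, depending on \<open>\<omega>\<close> only, times
  \<open>|bargmann F (x - \<i> \<omega>)|\<close> (\<open>norm_gabor_eq_norm_bargmann\<close>). Here \<open>bargmann F\<close> is entire and bounded by
  \<open>C exp (2 \<pi> B |Im z|)\<close>, because the support of \<open>F\<close> is bounded.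

  On a line, the difference of the squared moduli of \<open>bargmann F\<close> and \<open>bargmann G\<close> is the restriction of an
  entire function of exponential type \<open>4 \<pi> B\<close>. Two uniqueness theorems then extend the agreement of the
  moduli from the grid to the plane (\<open>phase_retrieval_on_grid\<close>). On horizontal lines this function is bounded on the
  real axis, and such a function has at most \<open>4 B\<close> zeros per unit length unless it vanishes
  (\<open>exponential_type_eq_0_if_zeros_dense\<close>); this is where the density of \<open>X\<close> enters. On vertical lines it is
  bounded on the imaginary axis instead, and Blaschke's condition for a half-plane makes the sum of the
  reciprocals of its real zeros finite (\<open>eq_0_if_reciprocal_zeros_not_summable\<close>); this is where \<open>\<Omega>\<close> enters.
  Both rest on Jensen's inequality for a disc, proved by dividing out zeros and the maximum principle.

  Two entire functions with equal moduli differ by a unimodular constant \<open>c\<close>. The moments of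
  \<open>F s exp (- \<pi> s\<^sup>2)\<close> are thus \<open>c\<close> times those of \<open>G s exp (- \<pi> s\<^sup>2)\<close>, which gives \<open>f = c g\<close> (\<open>fourier_eq_if_bargmann_eq\<close>).
\<close>

section \<open>Zeros on a disc: two forms of Jensen's inequality\<close>

text \<open>
  Multiplying \<open>f(z)/(z - a)\<close> by \<open>(R\<^sup>2 - cnj a z)/R\<close> removes the zero \<open>a\<close> without changing
  the modulus on the sphere, while the modulus at the centre grows by the factor \<open>R/|a|\<close>.
  These are inverse Blaschke factors of the disc of radius \<open>R\<close>. Each division keeps the other
  zeros, so the zeros can be removed one at a time.
\<close>

lemma divide_out_zeros_on_disc:
  fixes f :: "complex \<Rightarrow> complex"
  assumes "finite A" "f holomorphic_on S" "open S" "cball 0 R \<subseteq> S"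
    and "A \<subseteq> ball 0 R - {0}" "\<And>a. a \<in> A \<Longrightarrow> f a = 0"
  shows "\<exists>g. g holomorphic_on S \<and> (\<forall>z. cmod z = R \<longrightarrow> cmod (g z) = cmod (f z)) \<and>
           cmod (g 0) = cmod (f 0) * (\<Prod>a\<in>A. R / cmod a)"
  using assms
proof (induction A arbitrary: f rule: finite_induct)
  case empty
  then show ?case by auto
next
  case (insert a A)
  define q where "q = (\<lambda>z. if z = a then deriv f a else (f z - f a) / (z - a))"
  define h where "h = (\<lambda>z. q z * ((of_real (R\<^sup>2) - cnj a * z) / of_real R))"
  have fa: "f a = 0" and a: "a \<noteq> 0" "cmod a < R" and R: "R > 0"
    using insert.prems by (auto intro: le_less_trans[OF norm_ge_zero])
  have "q holomorphic_on S"
    unfolding q_def by (rule pole_lemma_open) (use insert.prems in auto)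
  then have holh: "h holomorphic_on S"
    unfolding h_def using R by (intro holomorphic_intros) auto
  have hz: "h b = 0" if "b \<in> A" for b
    using that insert by (auto simp: h_def q_def)
  obtain g where g: "g holomorphic_on S" "\<And>z. cmod z = R \<Longrightarrow> cmod (g z) = cmod (h z)"
      "cmod (g 0) = cmod (h 0) * (\<Prod>a\<in>A. R / cmod a)"
    using insert.IH[OF holh] hz insert.prems by auto
  have h_sphere: "cmod (h z) = cmod (f z)" if z: "cmod z = R" for z
  proof -
    have "of_real (R\<^sup>2) - cnj a * z = z * cnj (z - a)"
      using z by (simp add: algebra_simps complex_norm_square[symmetric])
    then have "cmod (of_real (R\<^sup>2) - cnj a * z) = R * cmod (z - a)"
      using z by (simp only: norm_mult complex_mod_cnj)
    moreover have "z \<noteq> a" using z a by auto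
    ultimately show ?thesis
      using R by (simp add: h_def q_def fa norm_mult norm_divide)
  qed
  have "cmod (h 0) = cmod (f 0) * (R / cmod a)"
    using a R by (simp add: h_def q_def fa norm_mult norm_divide power2_eq_square)
  then show ?case
    using g h_sphere insert.hyps by (intro exI[of _ g]) auto
qed

lemma norm_at_centre_le_sphere:
  fixes f :: "complex \<Rightarrow> complex"
  assumes "f holomorphic_on S" "cball 0 R \<subseteq> S" "R > 0"
    and "\<And>z. cmod z = R \<Longrightarrow> cmod (f z) \<le> M"
  shows "cmod (f 0) \<le> M"
proof (rule maximum_modulus_frontier[of f "ball 0 R"])
  show "f holomorphic_on interior (ball 0 R)"
    using assms by (auto intro: holomorphic_on_subset[OF assms(1)] simp: subset_iff)
  show "continuous_on (closure (ball 0 R)) f"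
    using assms by (auto intro: continuous_on_subset[OF holomorphic_on_imp_continuous_on[OF assms(1)]])
qed (use assms in auto)

lemma jensen_bounded:
  fixes f :: "complex \<Rightarrow> complex"
  assumes "f holomorphic_on S" "open S" "cball 0 R \<subseteq> S" "R > 0"
    and "finite A" "A \<subseteq> ball 0 R - {0}" "\<And>a. a \<in> A \<Longrightarrow> f a = 0"
    and bound: "\<And>z. cmod z = R \<Longrightarrow> cmod (f z) \<le> M"
  shows "cmod (f 0) * (\<Prod>a\<in>A. R / cmod a) \<le> M"
proof -
  obtain g where g: "g holomorphic_on S" "\<And>z. cmod z = R \<Longrightarrow> cmod (g z) = cmod (f z)"
      "cmod (g 0) = cmod (f 0) * (\<Prod>a\<in>A. R / cmod a)"
    using divide_out_zeros_on_disc[of A f S R] assms by blast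
  have "cmod (g 0) \<le> M"
    by (rule norm_at_centre_le_sphere[OF g(1) assms(3,4)]) (simp add: g(2) bound)
  then show ?thesis by (simp add: g(3))
qed

text \<open>
  Discrete counterpart of the fact that \<open>|sin|\<close> has mean \<open>2/\<pi>\<close>: after division by \<open>n\<close>, the bound
  tends to \<open>2/\<pi>\<close>. The sum is periodic with period \<open>\<pi>/n\<close>, so the offset may be taken in
  \<open>[0, \<pi>/n)\<close>, where no term changes sign and the sum telescopes.
\<close>

lemma sum_abs_sin_equidistant_le:
  fixes \<theta> :: real
  assumes "n > 0"
  shows "(\<Sum>j<n. \<bar>sin (\<theta> + pi * real j / real n)\<bar>) \<le> 1 / sin (pi / (2 * real n))"
proof -
  define S where "S = (\<lambda>\<theta>. \<Sum>j<n. \<bar>sin (\<theta> + pi * real j / real n)\<bar>)"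
  have "S (\<theta> + pi / real n) = S \<theta>" for \<theta>
  proof -
    define u where "u = (\<lambda>j. \<bar>sin (\<theta> + pi * real j / real n)\<bar>)"
    have "S (\<theta> + pi / real n) = (\<Sum>j<n. u (Suc j))"
      unfolding S_def u_def by (simp add: add_divide_distrib distrib_left add.assoc)
    also have "\<dots> = (\<Sum>j<n. u j) + u n - u 0"
      using sum.lessThan_Suc_shift[of u n] sum.lessThan_Suc[of u n] by simp
    also have "u n = u 0"
      using assms by (simp add: u_def)
    finally show ?thesis by (simp add: S_def u_def)
  qed
  then interpret periodic_fun_simple S "pi / real n"
    by unfold_locales
  define k where "k = \<lfloor>\<theta> / (pi / real n)\<rfloor>"
  define \<phi> where "\<phi> = \<theta> - of_int k * (pi / real n)"
  have pn: "pi / real n > 0" using assms by simp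
  have "of_int k \<le> \<theta> / (pi / real n)" "\<theta> / (pi / real n) < of_int k + 1"
    unfolding k_def by linarith+
  then have "of_int k * (pi / real n) \<le> \<theta>" "\<theta> < (of_int k + 1) * (pi / real n)"
    using pn by (simp_all only: pos_le_divide_eq pos_divide_less_eq)
  then have \<phi>: "0 \<le> \<phi>" "\<phi> < pi / real n"
    unfolding \<phi>_def by (simp_all add: algebra_simps add_divide_distrib)
  have "S \<theta> = S \<phi>"
    using plus_of_int[of \<phi> k] by (simp add: \<phi>_def)
  define s where "s = sin (pi / (2 * real n))"
  have s: "s > 0"
    unfolding s_def using assms by (intro sin_gt_zero) (auto simp: field_simps)
  have nonneg: "sin (\<phi> + pi * real j / real n) \<ge> 0" if "j < n" for j
  proof (rule sin_ge_zero)
    have "pi * real j / real n + pi / real n = pi * (real (Suc j) / real n)"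
      by (simp add: add_divide_distrib distrib_left)
    also have "\<dots> \<le> pi"
      using that by (intro mult_left_le) (auto simp: field_simps)
    finally show "\<phi> + pi * real j / real n \<le> pi" using \<phi> by linarith
  qed (use \<phi> in auto)
  have "2 * s * S \<phi> = (\<Sum>j<n. 2 * s * sin (\<phi> + pi * real j / real n))"
    unfolding S_def sum_distrib_left using nonneg by (intro sum.cong) auto
  also have "\<dots> = (\<Sum>j<n. cos (\<phi> - pi / (2 * real n) + pi * real j / real n)
                         - cos (\<phi> - pi / (2 * real n) + pi * real (Suc j) / real n))"
  proof (rule sum.cong)
    fix j
    define a where "a = \<phi> + pi * real j / real n"
    define b where "b = pi / (2 * real n)"
    have 1: "2 * sin b * sin a = cos (a - b) - cos (a + b)"
      by (simp add: cos_add cos_diff)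
    have 2: "a - b = \<phi> - pi / (2 * real n) + pi * real j / real n"
      by (simp add: a_def b_def)
    have "pi / real n = b + b" by (simp add: b_def)
    then have 3: "a + b = \<phi> - pi / (2 * real n) + pi * real (Suc j) / real n"
      unfolding b_def[symmetric] a_def by (simp add: distrib_left add_divide_distrib)
    show "2 * s * sin (\<phi> + pi * real j / real n) =
        cos (\<phi> - pi / (2 * real n) + pi * real j / real n)
        - cos (\<phi> - pi / (2 * real n) + pi * real (Suc j) / real n)"
      using 1 unfolding 2 3 by (simp only: a_def b_def s_def)
  qed simp
  also have "\<dots> = 2 * cos (\<phi> - pi / (2 * real n))"
    using assms by (subst sum_lessThan_telescope') simp
  also have "\<dots> \<le> 2" by simp
  finally have "S \<phi> \<le> 1 / s"
    using s by (simp add: field_simps)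
  then show ?thesis
    using \<open>S \<theta> = S \<phi>\<close> by (simp add: S_def s_def)
qed

text \<open>
  Jensen's formula bounds the left-hand side by the mean of \<open>|f|\<close> over the circle in the geometric
  sense, that is by \<open>C exp(2 \<tau> R/\<pi>)\<close>, since \<open>|sin|\<close> has mean \<open>2/\<pi>\<close>; a bound by the maximum would only give
  \<open>C exp(\<tau> R)\<close>, which is too weak for a sharp density condition. The mean is taken over
  finitely many points: the product \<open>G\<close> of \<open>n\<close> rotated copies of the quotient is holomorphic,
  its value at \<open>0\<close> is an \<open>n\<close>-th power, and the maximum principle for \<open>G\<close> replaces the subharmonicity
  of \<open>ln |f|\<close>. As \<open>n\<close> grows, the exponent tends to \<open>2 \<tau> R/\<pi>\<close>.
\<close>

lemma jensen_exponential_type: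
  fixes f :: "complex \<Rightarrow> complex"
  assumes "f holomorphic_on UNIV" "R > 0" "n > 0" "\<tau> \<ge> 0" "C \<ge> 0"
    and "finite A" "A \<subseteq> ball 0 R - {0}" "\<And>a. a \<in> A \<Longrightarrow> f a = 0"
    and bound: "\<And>z. cmod (f z) \<le> C * exp (\<tau> * \<bar>Im z\<bar>)"
  shows "cmod (f 0) * (\<Prod>a\<in>A. R / cmod a)
           \<le> C * exp (\<tau> * R * (1 / (real n * sin (pi / (2 * real n)))))"
proof -
  obtain g where g: "g holomorphic_on UNIV" "\<And>z. cmod z = R \<Longrightarrow> cmod (g z) = cmod (f z)"
      "cmod (g 0) = cmod (f 0) * (\<Prod>a\<in>A. R / cmod a)"
    using divide_out_zeros_on_disc[of A f UNIV R] assms by blast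
  \<comment> \<open>Angles up to \<open>\<pi>\<close> suffice, because \<open>|Im z|\<close> is invariant under \<open>z \<mapsto> -z\<close>.\<close>
  define w where "w = (\<lambda>j. cis (pi * real j / real n))"
  define G where "G = (\<lambda>z. \<Prod>j<n. g (z * w j))"
  have holG: "G holomorphic_on UNIV"
    unfolding G_def
    by (intro holomorphic_intros holomorphic_on_compose_gen[OF _ g(1), unfolded o_def]) auto
  define M where "M = C * exp (\<tau> * R * (1 / (real n * sin (pi / (2 * real n)))))"
  have "cmod (G z) \<le> M ^ n" if z: "cmod z = R" for z
  proof -
    obtain \<theta> where \<theta>: "z = of_real R * cis \<theta>"
      using z by (metis cis_def complex_norm_eq_1_exp rcis_cmod_Arg rcis_def)
    have im: "Im (z * w j) = R * sin (\<theta> + pi * real j / real n)" for j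
    proof -
      have "z * w j = of_real R * cis (\<theta> + pi * real j / real n)"
        by (simp only: \<theta> w_def cis_mult mult.assoc)
      then show ?thesis by simp
    qed
    have "cmod (G z) = (\<Prod>j<n. cmod (f (z * w j)))"
      unfolding G_def prod_norm[symmetric] using z
      by (intro prod.cong) (auto simp: g(2) norm_mult w_def)
    also have "\<dots> \<le> (\<Prod>j<n. C * exp (\<tau> * R * \<bar>sin (\<theta> + pi * real j / real n)\<bar>))"
    proof (rule prod_mono, safe)
      fix j
      show "cmod (f (z * w j)) \<le> C * exp (\<tau> * R * \<bar>sin (\<theta> + pi * real j / real n)\<bar>)"
        using bound[of "z * w j"] \<open>R > 0\<close> unfolding im by (simp add: abs_mult mult.assoc)
    qed simp
    also have "\<dots> = C ^ n * exp (\<tau> * R * (\<Sum>j<n. \<bar>sin (\<theta> + pi * real j / real n)\<bar>))"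
      by (simp add: prod.distrib exp_sum[symmetric] sum_distrib_left)
    also have "\<dots> \<le> C ^ n * exp (\<tau> * R * (1 / sin (pi / (2 * real n))))"
      using sum_abs_sin_equidistant_le[OF \<open>n > 0\<close>, of \<theta>] assms
      by (intro mult_left_mono iffD2[OF exp_le_cancel_iff] mult_nonneg_nonneg zero_le_power) simp_all
    also have "\<dots> = M ^ n"
      using \<open>n > 0\<close> by (simp add: M_def power_mult_distrib exp_of_nat_mult[symmetric])
    finally show ?thesis .
  qed
  then have "cmod (G 0) \<le> M ^ n"
    by (intro norm_at_centre_le_sphere[OF holG]) (use assms in auto)
  then have "cmod (g 0) ^ n \<le> M ^ n"
    by (simp add: G_def norm_power)
  moreover have "M \<ge> 0" using assms by (simp add: M_def)
  ultimately have "cmod (g 0) \<le> M"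
    using \<open>n > 0\<close> power_mono_iff norm_ge_zero by blast
  then show ?thesis by (simp add: g(3) M_def)
qed

section \<open>A uniqueness theorem for densely spaced zeros\<close>

text \<open>
  A weak form of Stirling's formula, bounding \<open>ln (k^k/k!)\<close> from below.
\<close>

lemma sum_ln_quotients_ge:
  assumes "k > 0"
  shows "(\<Sum>m<k. ln (real k / real (Suc m))) \<ge> real k - 1 - ln (real k)"
proof -
  have "(\<Sum>m<k. ln (real (Suc m))) \<le> real k * ln (real k) - real k + 1 + ln (real k)"
    using assms
  proof (induction k rule: nat_induct_non_zero)
    case 1
    then show ?case by simp
  next
    case (Suc k)
    have "ln (real k / real (Suc k)) \<le> real k / real (Suc k) - 1"
      using Suc by (intro ln_le_minus_one) simp
    also have "\<dots> = - (1 / real (Suc k))" by (simp add: field_simps)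
    finally have "1 / real (Suc k) \<le> ln (real (Suc k)) - ln (real k)"
      using Suc by (simp add: ln_div)
    then have "1 \<le> real (Suc k) * (ln (real (Suc k)) - ln (real k))"
      by (simp add: field_simps)
    then show ?case using Suc by (simp add: algebra_simps)
  qed
  moreover have "(\<Sum>m<k. ln (real k / real (Suc m))) = real k * ln (real k) - (\<Sum>m<k. ln (real (Suc m)))"
    using assms by (simp add: ln_div sum_subtractf del: of_nat_Suc)
  ultimately show ?thesis by linarith
qed

lemma entire_eq_0_if_eq_0_on_positive_reals:
  fixes f :: "complex \<Rightarrow> complex"
  assumes "f holomorphic_on UNIV" "\<And>x::real. x > 0 \<Longrightarrow> f (of_real x) = 0"
  shows "f z = 0"
proof (rule analytic_continuation[OF assms(1)])
  show "(1::complex) islimpt of_real ` {0<..}"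
  proof (subst islimpt_sequential, intro exI conjI allI)
    show "of_real (1 + 1 / real (Suc n)) \<in> of_real ` {0<..} - {1::complex}" for n
    proof -
      have "1 + 1 / real (Suc n) \<noteq> 1" "0 < 1 + 1 / real (Suc n)" by (auto simp: add_pos_pos)
      then show ?thesis by (metis DiffI image_eqI greaterThan_iff of_real_eq_1_iff singletonD)
    qed
    have "(\<lambda>n. 1 + 1 / real (Suc n)) \<longlonglongrightarrow> 1" by real_asymp
    then show "(\<lambda>n. of_real (1 + 1 / real (Suc n)) :: complex) \<longlonglongrightarrow> 1"
      using tendsto_of_real[of "\<lambda>n. 1 + 1 / real (Suc n)" 1 sequentially, where 'a = complex] by simp
  qed
qed (use assms in auto)

text \<open>
  An entire function of exponential type \<open>\<tau>\<close> that is bounded on the real line has at most about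
  \<open>\<tau> L/\<pi>\<close> zeros per length \<open>L\<close>. Around a real point \<open>x0\<close> with \<open>f x0 \<noteq> 0\<close>, a disc of radius \<open>R = k r1\<close>
  meets \<open>2 k\<close> blocks of length \<open>r1\<close>, each with at least \<open>N\<close> zeros, and \<open>\<Sum> ln (R/|a|)\<close> over these zeros is at least
  \<open>2 N (k - 1 - ln k)\<close>. By Jensen's inequality it is at most about \<open>2 \<tau> r1 k/\<pi>\<close> plus a constant, which is
  impossible for large \<open>k\<close> as \<open>\<tau> r1 < \<pi> N\<close>.
\<close>

theorem exponential_type_eq_0_if_zeros_dense:
  fixes f :: "complex \<Rightarrow> complex" and X :: "real set" and N :: nat
  assumes hol: "f holomorphic_on UNIV" and "\<tau> \<ge> 0"
    and bound: "\<And>z. cmod (f z) \<le> C * exp (\<tau> * \<bar>Im z\<bar>)"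
    and fin: "\<And>a b. finite (X \<inter> {a..b})"
    and "r > 0" and count: "\<And>t. N \<le> card (X \<inter> {t..t + r})"
    and dense: "\<tau> * r < pi * real N"
    and zeros: "\<And>x. x \<in> X \<Longrightarrow> f (of_real x) = 0"
  shows "f z = 0"
proof -
  have "f (of_real x0) = 0" for x0
  proof (rule ccontr)
    assume nz: "f (of_real x0) \<noteq> 0"
    have "N > 0" using dense \<open>\<tau> \<ge> 0\<close> \<open>r > 0\<close>
      by (metis gr0I mult_nonneg_nonneg mult_zero_right not_less of_nat_0 less_imp_le)
    \<comment> \<open>Blocks slightly longer than \<open>r\<close> leave a gap, so that neighbouring closed intervals are disjoint.\<close>
    obtain r1 where r1: "r1 > r" "\<tau> * r1 < pi * real N"
    proof (cases "\<tau> = 0")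
      case True
      then show ?thesis using that[of "r + 1"] \<open>N > 0\<close> by simp
    next
      case False
      then have "r < pi * real N / \<tau>" using dense \<open>\<tau> \<ge> 0\<close> by (simp add: field_simps)
      then obtain r1 where "r < r1" "r1 < pi * real N / \<tau>" using dense_order_class.dense by blast
      then show ?thesis using that[of r1] False \<open>\<tau> \<ge> 0\<close> by (simp add: field_simps)
    qed
    have "(\<lambda>n. \<tau> * r1 * (1 / (real n * sin (pi / (2 * real n))))) \<longlonglongrightarrow> \<tau> * r1 * (2 / pi)"
    proof (rule tendsto_mult_left)
      show "(\<lambda>n. 1 / (real n * sin (pi / (2 * real n)))) \<longlonglongrightarrow> 2 / pi" by real_asymp
    qed
    moreover have "\<tau> * r1 * (2 / pi) < 2 * real N"
      using r1 by (simp add: field_simps)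
    ultimately have "\<forall>\<^sub>F n in sequentially. \<tau> * r1 * (1 / (real n * sin (pi / (2 * real n)))) < 2 * real N"
      by (rule order_tendstoD)
    then have "\<forall>\<^sub>F n in sequentially. n > 0 \<and> \<tau> * r1 * (1 / (real n * sin (pi / (2 * real n)))) < 2 * real N"
      using eventually_gt_at_top[of 0] by eventually_elim simp
    then obtain n where n: "n > 0"
        "\<tau> * r1 * (1 / (real n * sin (pi / (2 * real n)))) < 2 * real N"
      using eventually_happens' sequentially_bot by blast
    define \<sigma> where "\<sigma> = \<tau> * r1 * (1 / (real n * sin (pi / (2 * real n))))"
    define g where "g = (\<lambda>z. f (z + of_real x0))"
    have C: "C > 0"
      using bound[of "of_real x0"] nz by (metis Im_complex_of_real abs_zero exp_zero less_le_trans mult.right_neutral mult_zero_right zero_less_norm_iff)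
    have holg: "g holomorphic_on UNIV"
      unfolding g_def by (intro holomorphic_intros holomorphic_on_compose_gen[OF _ hol, unfolded o_def]) auto
    have growth: "ln (cmod (g 0)) + 2 * real N * (real k - 1 - ln (real k)) \<le> ln C + \<sigma> * real k"
      if k: "k > 0" for k
    proof -
      define R where "R = real k * r1"
      have R: "R > 0" using k r1 \<open>r > 0\<close> by (simp add: R_def)
      define A where "A = {a. x0 + a \<in> X \<and> \<bar>a\<bar> < R}"
      have finA: "finite A"
      proof (rule finite_subset)
        show "A \<subseteq> (\<lambda>y. y - x0) ` (X \<inter> {x0 - R..x0 + R})"
        proof
          fix a assume "a \<in> A"
          then show "a \<in> (\<lambda>y. y - x0) ` (X \<inter> {x0 - R..x0 + R})"
            by (intro image_eqI[of _ _ "x0 + a"]) (auto simp: A_def)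
        qed
      qed (simp add: fin)
      have A0: "a \<noteq> 0" if "a \<in> A" for a
        using that zeros nz by (auto simp: A_def)
      have "cmod (g 0) * (\<Prod>a\<in>of_real ` A. R / cmod a) \<le> C * exp (\<tau> * R * (1 / (real n * sin (pi / (2 * real n)))))"
      proof (rule jensen_exponential_type[OF holg R n(1) \<open>\<tau> \<ge> 0\<close>])
        show "cmod (g z) \<le> C * exp (\<tau> * \<bar>Im z\<bar>)" for z
          using bound[of "z + of_real x0"] by (simp add: g_def)
        show "g a = 0" if "a \<in> of_real ` A" for a
          using that zeros by (auto simp: g_def A_def add.commute simp flip: of_real_add)
      qed (use finA C A0 in \<open>auto simp: A_def\<close>)
      moreover have "(\<Prod>a\<in>of_real ` A. R / cmod a) = (\<Prod>a\<in>A. R / \<bar>a\<bar>)"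
        by (subst prod.reindex) (auto simp: inj_on_def)
      moreover have "\<tau> * R * (1 / (real n * sin (pi / (2 * real n)))) = \<sigma> * real k"
        by (simp add: \<sigma>_def R_def)
      ultimately have "cmod (g 0) * (\<Prod>a\<in>A. R / \<bar>a\<bar>) \<le> C * exp (\<sigma> * real k)"
        by simp
      moreover have pos: "(\<Prod>a\<in>A. R / \<bar>a\<bar>) > 0"
        using A0 R by (intro prod_pos) auto
      moreover have g0: "cmod (g 0) > 0" using nz by (simp add: g_def)
      ultimately have "ln (cmod (g 0) * (\<Prod>a\<in>A. R / \<bar>a\<bar>)) \<le> ln (C * exp (\<sigma> * real k))"
        using C by (subst ln_le_cancel_iff) auto
      then have "ln (cmod (g 0)) + ln (\<Prod>a\<in>A. R / \<bar>a\<bar>) \<le> ln C + \<sigma> * real k"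
        using pos g0 C by (simp add: ln_mult)
      moreover have "ln (\<Prod>a\<in>A. R / \<bar>a\<bar>) = (\<Sum>a\<in>A. ln (R / \<bar>a\<bar>))"
        using finA A0 R by (subst ln_prod) auto
      moreover have "(\<Sum>a\<in>A. ln (R / \<bar>a\<bar>)) \<ge> 2 * real N * (\<Sum>m<k. ln (real k / real (Suc m)))"
      proof -
        \<comment> \<open>Block \<open>i\<close> is \<open>[i r1, (i + 1) r1)\<close>; none of its points is farther than \<open>c i * r1\<close> from \<open>0\<close>.\<close>
        define c where "c = (\<lambda>i::int. if i \<ge> 0 then i + 1 else - i)"
        define I where "I = {- int k..<int k}"
        define F where "F = (\<lambda>i. {a \<in> A. \<lfloor>a / r1\<rfloor> = i})"
        have "r1 > 0" using r1 \<open>r > 0\<close> by simp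
        have c_bounds: "1 \<le> c i" "c i \<le> int k" if "i \<in> I" for i
          using that by (auto simp: c_def I_def)
        have fibre: "real N * ln (real k / of_int (c i)) \<le> (\<Sum>a\<in>F i. ln (R / \<bar>a\<bar>))"
          if i: "i \<in> I" for i
        proof -
          have cp: "real_of_int (c i) \<ge> 1" "real_of_int (c i) \<le> real k"
            using c_bounds[OF i] by linarith+
          define h where "h = (r1 - r) / 2"
          have h: "h > 0" "h + r < r1" using r1 by (simp_all add: h_def field_simps)
          define t where "t = x0 + of_int i * r1 + h"
          have "(\<lambda>y. y - x0) ` (X \<inter> {t..t + r}) \<subseteq> F i"
          proof safe
            fix y assume y: "y \<in> X" "y \<in> {t..t + r}"
            have "t \<le> y" "y \<le> t + r" using y by auto
            have b: "of_int i * r1 < y - x0" "y - x0 < (of_int i + 1) * r1"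
              using \<open>t \<le> y\<close> \<open>y \<le> t + r\<close> h unfolding t_def distrib_right mult_1_left by linarith+
            then have fl: "\<lfloor>(y - x0) / r1\<rfloor> = i"
              using \<open>r1 > 0\<close> by (intro floor_unique) (simp_all add: field_simps)
            have "- real k \<le> of_int i" "of_int i + 1 \<le> real k"
              using i unfolding I_def by auto
            then have "- real k * r1 \<le> of_int i * r1" "(of_int i + 1) * r1 \<le> real k * r1"
              using \<open>r1 > 0\<close> by (intro mult_right_mono; simp)+
            then have "\<bar>y - x0\<bar> < R"
              using b by (simp add: R_def)
            then show "y - x0 \<in> F i"
              using y fl by (simp add: F_def A_def)
          qed
          then have "card ((\<lambda>y. y - x0) ` (X \<inter> {t..t + r})) \<le> card (F i)"
            using finA by (intro card_mono) (auto simp: F_def)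
          then have "N \<le> card (F i)"
            using count[of t] by (subst (asm) card_image) (auto simp: inj_on_def)
          then have "real N * ln (real k / of_int (c i)) \<le> real (card (F i)) * ln (real k / of_int (c i))"
            using cp by (intro mult_right_mono) auto
          also have "\<dots> = (\<Sum>a\<in>F i. ln (real k / of_int (c i)))" by simp
          also have "\<dots> \<le> (\<Sum>a\<in>F i. ln (R / \<bar>a\<bar>))"
          proof (rule sum_mono)
            fix a assume a: "a \<in> F i"
            then have "a \<noteq> 0" using A0 by (simp add: F_def)
            have "of_int i \<le> a / r1" "a / r1 < of_int i + 1"
              using a unfolding F_def by (auto simp: floor_eq_iff)
            then have "of_int i * r1 \<le> a" "a < (of_int i + 1) * r1"
              using \<open>r1 > 0\<close> by (simp_all add: field_simps)
            moreover have "(of_int i + 1) * r1 \<le> 0" if "i < 0"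
              using that \<open>r1 > 0\<close> by (intro mult_nonpos_nonneg) linarith+
            moreover have "of_int i * r1 \<ge> 0" if "i \<ge> 0"
              using that \<open>r1 > 0\<close> by simp
            ultimately have "\<bar>a\<bar> \<le> of_int (c i) * r1"
              by (cases "i \<ge> 0") (auto simp: c_def)
            then have "real k / of_int (c i) \<le> R / \<bar>a\<bar>"
              using \<open>a \<noteq> 0\<close> cp \<open>r1 > 0\<close> k
              by (simp add: R_def field_simps mult_left_mono)
            then show "ln (real k / of_int (c i)) \<le> ln (R / \<bar>a\<bar>)"
              using cp k by (intro ln_mono) auto
          qed
          finally show ?thesis .
        qed
        have "(\<Sum>i\<in>I. ln (real k / of_int (c i))) =
              (\<Sum>i\<in>{- int k..<0}. ln (real k / of_int (c i))) + (\<Sum>i\<in>{0..<int k}. ln (real k / of_int (c i)))"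
          unfolding I_def by (subst sum.union_disjoint[symmetric]) (auto intro!: sum.cong)
        also have "(\<Sum>i\<in>{- int k..<0}. ln (real k / of_int (c i))) = (\<Sum>m<k. ln (real k / real (Suc m)))"
          by (rule sum.reindex_bij_witness[of _ "\<lambda>m. - int m - 1" "\<lambda>i. nat (- i - 1)"])
             (auto simp: c_def)
        also have "(\<Sum>i\<in>{0..<int k}. ln (real k / of_int (c i))) = (\<Sum>m<k. ln (real k / real (Suc m)))"
          by (rule sum.reindex_bij_witness[of _ int nat]) (auto simp: c_def)
        finally have "2 * real N * (\<Sum>m<k. ln (real k / real (Suc m))) = (\<Sum>i\<in>I. real N * ln (real k / of_int (c i)))"
          by (simp add: sum_distrib_left[symmetric])
        also have "\<dots> \<le> (\<Sum>i\<in>I. \<Sum>a\<in>F i. ln (R / \<bar>a\<bar>))"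
          by (rule sum_mono) (rule fibre)
        also have "\<dots> = (\<Sum>a\<in>A. ln (R / \<bar>a\<bar>))"
          unfolding F_def
        proof (rule sum.group[OF finA])
          show "(\<lambda>a. \<lfloor>a / r1\<rfloor>) ` A \<subseteq> I"
          proof (rule image_subsetI)
            fix a assume "a \<in> A"
            then have "\<bar>a\<bar> < real k * r1" by (simp add: A_def R_def)
            then have "- real k \<le> a / r1" "a / r1 < real k"
              using \<open>r1 > 0\<close> by (auto simp: field_simps abs_less_iff)
            then show "\<lfloor>a / r1\<rfloor> \<in> I"
              by (auto simp: I_def le_floor_iff floor_less_iff)
          qed
        qed (simp add: I_def)
        finally show ?thesis .
      qed
      moreover have "2 * real N * (real k - 1 - ln (real k)) \<le> 2 * real N * (\<Sum>m<k. ln (real k / real (Suc m)))"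
        using sum_ln_quotients_ge[OF k] by (intro mult_left_mono) auto
      ultimately show ?thesis by linarith
    qed
    define d where "d = 2 * real N - \<sigma>"
    have "d > 0" using n by (simp add: d_def \<sigma>_def)
    then have "filterlim (\<lambda>k. d * real k - 2 * real N * ln (real k)) at_top sequentially"
      by real_asymp
    then have "\<forall>\<^sub>F k in sequentially. d * real k - 2 * real N * ln (real k) > ln C - ln (cmod (g 0)) + 2 * real N"
      by (simp add: filterlim_at_top_dense)
    then have "\<forall>\<^sub>F k in sequentially. k > 0 \<and> d * real k - 2 * real N * ln (real k) > ln C - ln (cmod (g 0)) + 2 * real N"
      using eventually_gt_at_top[of 0] by eventually_elim simp
    then obtain k where k: "k > 0"
        "d * real k - 2 * real N * ln (real k) > ln C - ln (cmod (g 0)) + 2 * real N"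
      using eventually_happens' sequentially_bot by blast
    show False
      using growth[OF k(1)] k(2) by (simp add: d_def algebra_simps)
  qed
  then show ?thesis
    using entire_eq_0_if_eq_0_on_positive_reals[OF hol] by blast
qed

section \<open>A uniqueness theorem for zeros with divergent reciprocal sum\<close>

text \<open>
  Blaschke's condition. In the right half-plane \<open>h z * exp (- \<tau> z)\<close> is bounded, and the Cayley
  transform centred at a positive \<open>x0\<close> with \<open>h x0 \<noteq> 0\<close> turns it into a bounded function on the unit
  disc whose zeros are \<open>(x - x0)/(x + x0)\<close>. Since \<open>1 - (x - x0)/(x + x0) \<ge> x0/x\<close> for \<open>x > x0\<close>, Jensen's inequality
  bounds \<open>\<Sum> 1/x\<close> over these \<open>x\<close>. Only finitely many zeros lie in \<open>(0, x0]\<close>.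
\<close>

lemma summable_reciprocal_positive_zeros:
  fixes h :: "complex \<Rightarrow> complex" and \<Lambda> :: "real set"
  assumes hol: "h holomorphic_on UNIV" and nz: "h \<zeta> \<noteq> 0"
    and bound: "\<And>z. cmod (h z) \<le> C * exp (\<tau> * \<bar>Re z\<bar>)"
    and pos: "\<Lambda> \<subseteq> {0<..}" and zeros: "\<And>x. x \<in> \<Lambda> \<Longrightarrow> h (of_real x) = 0"
  shows "(\<lambda>x. 1 / \<bar>x\<bar>) summable_on \<Lambda>"
proof -
  obtain x0 :: real where x0: "x0 > 0" "h (of_real x0) \<noteq> 0"
    using entire_eq_0_if_eq_0_on_positive_reals[OF hol] nz by blast
  have near: "finite (\<Lambda> \<inter> {..x0})"
  proof (rule ccontr)
    assume "infinite (\<Lambda> \<inter> {..x0})"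
    then have inf: "infinite (complex_of_real ` (\<Lambda> \<inter> {..x0}))"
      by (subst finite_image_iff) (auto simp: inj_on_def)
    have "bounded (complex_of_real ` (\<Lambda> \<inter> {..x0}))"
      using pos by (auto intro!: boundedI[of _ x0])
    then obtain \<xi> where \<xi>: "\<xi> islimpt complex_of_real ` (\<Lambda> \<inter> {..x0})"
      using bounded_infinite_imp_islimpt[OF order_refl _ inf] by blast
    have "h \<zeta> = 0"
      by (rule analytic_continuation[OF hol open_UNIV connected_UNIV subset_UNIV UNIV_I \<xi>]) (use zeros in auto)
    then show False using nz by simp
  qed
  define z where "z = (\<lambda>w::complex. of_real x0 * ((1 + w) / (1 - w)))"
  define k where "k = (\<lambda>w. h (z w) * exp (- of_real \<tau> * z w))"
  have holz: "z holomorphic_on ball 0 1"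
    unfolding z_def by (intro holomorphic_intros) auto
  have holk: "k holomorphic_on ball 0 1"
    unfolding k_def
    by (intro holomorphic_intros holz holomorphic_on_compose_gen[OF holz hol, unfolded o_def]) auto
  have z_right: "Re (z w) \<ge> 0" if "cmod w < 1" for w
  proof -
    have "(1 + w) / (1 - w) = (1 + w) * cnj (1 - w) / of_real ((cmod (1 - w))\<^sup>2)"
      using complex_div_cnj by blast
    then have "Re ((1 + w) / (1 - w)) = Re ((1 + w) * cnj (1 - w)) / (cmod (1 - w))\<^sup>2"
      by (simp only: Re_divide_of_real)
    moreover have "Re ((1 + w) * cnj (1 - w)) = 1 - (cmod w)\<^sup>2"
      unfolding cmod_power2 by (simp add: algebra_simps power2_eq_square)
    moreover have "(cmod w)\<^sup>2 \<le> 1" using that by (simp add: power_le_one)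
    ultimately have "Re ((1 + w) / (1 - w)) \<ge> 0" by simp
    moreover have "Re (z w) = x0 * Re ((1 + w) / (1 - w))"
      by (simp only: z_def scaleR_conv_of_real[symmetric] scaleR_complex.simps)
    ultimately show ?thesis using x0 by simp
  qed
  have k_bound: "cmod (k w) \<le> C" if "cmod w < 1" for w
  proof -
    have "cmod (k w) = cmod (h (z w)) * exp (- \<tau> * Re (z w))"
      by (simp add: k_def norm_mult)
    also have "\<dots> \<le> C * exp (\<tau> * Re (z w)) * exp (- \<tau> * Re (z w))"
      using bound[of "z w"] z_right[OF that] by (intro mult_right_mono) auto
    also have "\<dots> = C" by (simp add: mult.assoc flip: exp_add)
    finally show ?thesis .
  qed
  have k0: "cmod (k 0) > 0" using x0 by (simp add: k_def z_def)
  have C: "C > 0" using less_le_trans[OF k0 k_bound[of 0]] by simp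
  have bdd: "(\<Sum>x\<in>F. 1 / \<bar>x\<bar>) \<le> (ln C - ln (cmod (k 0))) / x0"
    if F: "finite F" "F \<subseteq> \<Lambda> \<inter> {x0<..}" for F
  proof -
    define a where "a = (\<lambda>x::real. (x - x0) / (x + x0))"
    have a01: "0 < a x" "a x < 1" if "x \<in> F" for x
      using that F x0 by (auto simp: a_def field_simps)
    have inj: "inj_on a F"
    proof (rule inj_onI)
      fix x y assume "x \<in> F" "y \<in> F" "a x = a y"
      moreover have "x > x0" "y > x0" using F \<open>x \<in> F\<close> \<open>y \<in> F\<close> by auto
      ultimately have "x0 * x = x0 * y" using x0 by (simp add: a_def field_simps)
      then show "x = y" using x0 by simp
    qed
    have za: "z (of_real (a x)) = of_real x" if "x \<in> F" for x
    proof -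
      have x: "x > x0" using F that by auto
      have "1 + a x = 2 * x / (x + x0)" "1 - a x = 2 * x0 / (x + x0)"
        using x x0 by (simp_all add: a_def field_simps)
      then have "(1 + a x) / (1 - a x) = x / x0"
        using x x0 by simp
      then have "x0 * ((1 + a x) / (1 - a x)) = x" using x0 by simp
      moreover have "z (of_real (a x)) = of_real (x0 * ((1 + a x) / (1 - a x)))"
        by (simp add: z_def)
      ultimately show ?thesis by simp
    qed
    have "\<forall>\<^sub>F R in at_left 1. cmod (k 0) * (\<Prod>x\<in>F. R / a x) \<le> C"
    proof -
      have "\<forall>\<^sub>F R in at_left (1::real). \<forall>x\<in>F. a x < R"
        using F(1) a01 by (subst eventually_ball_finite_distrib)
          (auto simp: eventually_at_left_field intro!: exI[of _ "a _"])
      moreover have "\<forall>\<^sub>F R in at_left (1::real). 0 < R \<and> R < 1"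
        by (auto simp: eventually_at_left_field intro!: exI[of _ 0])
      ultimately show ?thesis
      proof eventually_elim
        case (elim R)
        have "cmod (k 0) * (\<Prod>b\<in>(\<lambda>x. of_real (a x)) ` F. R / cmod b) \<le> C"
        proof (rule jensen_bounded[OF holk])
          show "(\<lambda>x. complex_of_real (a x)) ` F \<subseteq> ball 0 R - {0}"
            using a01 elim by (fastforce simp: abs_of_pos)
          show "k b = 0" if "b \<in> (\<lambda>x. complex_of_real (a x)) ` F" for b
            using that za zeros F by (auto simp: k_def)
          show "cmod (k w) \<le> C" if "cmod w = R" for w
            using k_bound that elim by simp
        qed (use elim F in auto)
        also have "(\<Prod>b\<in>(\<lambda>x. complex_of_real (a x)) ` F. R / cmod b) = (\<Prod>x\<in>F. R / a x)"
          using inj a01 by (subst prod.reindex) (auto simp: inj_on_def a01 abs_of_pos intro!: prod.cong)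
        finally show ?case .
      qed
    qed
    moreover have "((\<lambda>R. cmod (k 0) * (\<Prod>x\<in>F. R / a x)) \<longlongrightarrow> cmod (k 0) * (\<Prod>x\<in>F. 1 / a x)) (at_left 1)"
      by (intro tendsto_intros) (use a01 in force)
    ultimately have "cmod (k 0) * (\<Prod>x\<in>F. 1 / a x) \<le> C"
      by (intro tendsto_upperbound) auto
    moreover have "exp (\<Sum>x\<in>F. x0 / x) \<le> (\<Prod>x\<in>F. 1 / a x)"
      unfolding exp_sum[OF F(1)]
    proof (rule prod_mono, safe)
      fix x assume "x \<in> F"
      then have x: "x > x0" "a x > 0" using F a01 by auto
      have "a x = 1 + - (2 * x0 / (x + x0))" using x x0 by (simp add: a_def field_simps)
      also have "\<dots> \<le> exp (- (2 * x0 / (x + x0)))" by (rule exp_ge_add_one_self)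
      also have "\<dots> \<le> exp (- (x0 / x))" using x x0 by (simp add: field_simps)
      finally have "a x * exp (x0 / x) \<le> 1" by (simp add: exp_minus field_simps)
      then show "exp (x0 / x) \<le> 1 / a x" using x by (simp add: field_simps)
    qed simp
    ultimately have "cmod (k 0) * exp (\<Sum>x\<in>F. x0 / x) \<le> C"
      using k0 by (meson mult_left_mono less_imp_le order_trans)
    then have "ln (cmod (k 0) * exp (\<Sum>x\<in>F. x0 / x)) \<le> ln C"
      using k0 C by (subst ln_le_cancel_iff) auto
    then have "(\<Sum>x\<in>F. x0 / x) \<le> ln C - ln (cmod (k 0))"
      using k0 by (simp add: ln_mult)
    moreover have "(\<Sum>x\<in>F. x0 / x) = x0 * (\<Sum>x\<in>F. 1 / \<bar>x\<bar>)"
      unfolding sum_distrib_left using F x0 by (intro sum.cong) auto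
    ultimately show ?thesis using x0 by (simp add: field_simps)
  qed
  have far: "(\<lambda>x. 1 / \<bar>x\<bar>) summable_on (\<Lambda> \<inter> {x0<..})"
    by (rule nonneg_bdd_above_summable_on) (use bdd in \<open>auto intro!: bdd_aboveI2\<close>)
  have "(\<lambda>x. 1 / \<bar>x\<bar>) summable_on (\<Lambda> \<inter> {..x0} \<union> \<Lambda> \<inter> {x0<..})"
    by (rule summable_on_Un_disjoint[OF summable_on_finite[OF near] far]) auto
  also have "\<Lambda> \<inter> {..x0} \<union> \<Lambda> \<inter> {x0<..} = \<Lambda>" by auto
  finally show ?thesis .
qed

theorem eq_0_if_reciprocal_zeros_not_summable:
  fixes h :: "complex \<Rightarrow> complex" and \<Omega> :: "real set"
  assumes hol: "h holomorphic_on UNIV"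
    and bound: "\<And>z. cmod (h z) \<le> C * exp (\<tau> * \<bar>Re z\<bar>)"
    and zeros: "\<And>x. x \<in> \<Omega> \<Longrightarrow> h (of_real x) = 0"
    and div: "\<not> (\<lambda>x. 1 / \<bar>x\<bar>) summable_on (\<Omega> - {0})"
  shows "h z = 0"
proof (rule ccontr)
  assume nz: "h z \<noteq> 0"
  have pos: "(\<lambda>x. 1 / \<bar>x\<bar>) summable_on (\<Omega> \<inter> {0<..})"
    by (rule summable_reciprocal_positive_zeros[OF hol nz bound]) (use zeros in auto)
  have "(\<lambda>x. 1 / \<bar>x\<bar>) summable_on (uminus ` (\<Omega> \<inter> {..<0}))"
  proof (rule summable_reciprocal_positive_zeros)
    show "(\<lambda>z. h (- z)) holomorphic_on UNIV"
      by (intro holomorphic_intros holomorphic_on_compose_gen[OF _ hol, unfolded o_def]) auto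
    show "h (- (- z)) \<noteq> 0" using nz by simp
    show "cmod (h (- z)) \<le> C * exp (\<tau> * \<bar>Re z\<bar>)" for z
      using bound[of "- z"] by simp
  qed (use zeros in auto)
  then have neg: "(\<lambda>x. 1 / \<bar>x\<bar>) summable_on (\<Omega> \<inter> {..<0})"
    by (subst (asm) summable_on_reindex) (auto simp: o_def)
  have "(\<lambda>x. 1 / \<bar>x\<bar>) summable_on (\<Omega> \<inter> {0<..} \<union> \<Omega> \<inter> {..<0})"
    by (intro summable_on_Un_disjoint pos neg) auto
  also have "\<Omega> \<inter> {0<..} \<union> \<Omega> \<inter> {..<0} = \<Omega> - {0}" by auto
  finally show False using div by simp
qed

section \<open>Phase retrieval for entire functions\<close>

text \<open>
  On a real line the squared modulus of an entire function is the restriction of an entire function: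
  replace the conjugate \<open>cnj (\<Phi> (a + b x))\<close> by its holomorphic extension in \<open>x\<close>.
\<close>

lemma holomorphic_mult_cnj_reflection:
  fixes \<Phi> :: "complex \<Rightarrow> complex"
  assumes "\<Phi> holomorphic_on UNIV"
  shows "(\<lambda>z. \<Phi> (a + b * z) * cnj (\<Phi> (a + b * cnj z))) holomorphic_on UNIV"
proof -
  have h: "(\<lambda>z. \<Phi> (a + b * z)) holomorphic_on UNIV"
    by (intro holomorphic_intros holomorphic_on_compose_gen[OF _ assms, unfolded o_def]) auto
  have "(cnj \<circ> (\<lambda>z. \<Phi> (a + b * z)) \<circ> cnj) holomorphic_on UNIV"
    by (rule holomorphic_on_compose_cnj_cnj) (use holomorphic_on_subset[OF h] in auto)
  then show ?thesis
    using h by (intro holomorphic_on_mult) (auto simp: o_def)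
qed

lemma entire_eq_norm_imp_unimodular_multiple:
  fixes \<Phi> \<Gamma> :: "complex \<Rightarrow> complex"
  assumes "\<Phi> holomorphic_on UNIV" "\<Gamma> holomorphic_on UNIV"
    and eq: "\<And>z. cmod (\<Phi> z) = cmod (\<Gamma> z)"
  shows "\<exists>c. cmod c = 1 \<and> (\<forall>z. \<Phi> z = c * \<Gamma> z)"
proof (cases "\<exists>z. \<Gamma> z \<noteq> 0")
  case False
  then show ?thesis using eq by (intro exI[of _ 1]) (metis norm_eq_zero norm_one mult_zero_right)
next
  case True
  then obtain z0 where z0: "\<Gamma> z0 \<noteq> 0" by blast
  have cont: "continuous_on UNIV \<Gamma>"
    using assms holomorphic_on_imp_continuous_on by blast
  have "open (\<Gamma> -` (- {0}))"
    by (intro open_vimage cont) auto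
  then obtain e where e: "e > 0" "ball z0 e \<subseteq> \<Gamma> -` (- {0})"
    using z0 openE[of "\<Gamma> -` (- {0})" z0] by auto
  have nz: "\<Gamma> z \<noteq> 0" if "z \<in> ball z0 e" for z
    using that e by auto
  have "(\<lambda>z. \<Phi> z / \<Gamma> z) constant_on ball z0 e"
  proof (rule maximum_modulus_principle)
    show "(\<lambda>z. \<Phi> z / \<Gamma> z) holomorphic_on ball z0 e"
      by (intro holomorphic_intros holomorphic_on_subset[OF assms(1)]
            holomorphic_on_subset[OF assms(2)]) (use nz in auto)
    show "cmod (\<Phi> z / \<Gamma> z) \<le> cmod (\<Phi> z0 / \<Gamma> z0)" if "z \<in> ball z0 e" for z
      using nz[OF that] z0 by (simp add: norm_divide eq)
  qed (use e in auto)
  then obtain c where c: "\<And>z. z \<in> ball z0 e \<Longrightarrow> \<Phi> z / \<Gamma> z = c"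
    by (auto simp: constant_on_def)
  have "\<Phi> z = c * \<Gamma> z" for z
  proof (rule analytic_continuation_open[of "ball z0 e" UNIV \<Phi> "\<lambda>z. c * \<Gamma> z"])
    show "(\<lambda>z. c * \<Gamma> z) holomorphic_on UNIV"
      by (intro holomorphic_intros assms)
    show "\<Phi> z = c * \<Gamma> z" if "z \<in> ball z0 e" for z
      using c[OF that] nz[OF that] by (simp add: field_simps)
  qed (use e assms in auto)
  moreover have "cmod c = 1"
    using c[of z0] e z0 by (auto simp: norm_divide eq)
  ultimately show ?thesis by blast
qed

text \<open>
  The grid points are \<open>x - \<i> \<omega>\<close>. The difference \<open>|\<Phi>|\<^sup>2 - |\<Gamma>|\<^sup>2\<close> extends holomorphically from every horizontal
  and every vertical line. On the horizontal line through \<open>-\<i> \<omega>\<close> the extension has type \<open>2 \<beta>\<close> and is bounded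
  on the line, so its dense zeros \<open>X\<close> force it to vanish. On a vertical line the growth \<open>exp (\<beta> |Im z|)\<close>
  becomes \<open>exp (\<beta> |Re z|)\<close> in the line's own coordinate, so the zeros \<open>\<Omega>\<close> force it to vanish as well.
  Hence \<open>|\<Phi>| = |\<Gamma>|\<close> on the whole plane.
\<close>

theorem phase_retrieval_on_grid:
  fixes \<Phi> \<Gamma> :: "complex \<Rightarrow> complex" and X \<Omega> :: "real set" and N :: nat
  assumes hol: "\<Phi> holomorphic_on UNIV" "\<Gamma> holomorphic_on UNIV" and "\<beta> \<ge> 0"
    and bound: "\<And>z. cmod (\<Phi> z) \<le> C * exp (\<beta> * \<bar>Im z\<bar>)" "\<And>z. cmod (\<Gamma> z) \<le> C * exp (\<beta> * \<bar>Im z\<bar>)"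
    and fin: "\<And>a b. finite (X \<inter> {a..b})"
    and r: "r > 0" "\<And>t. N \<le> card (X \<inter> {t..t + r})" "2 * \<beta> * r < pi * real N"
    and div: "\<not> (\<lambda>x. 1 / \<bar>x\<bar>) summable_on (\<Omega> - {0})"
    and eq: "\<And>x \<omega>. x \<in> X \<Longrightarrow> \<omega> \<in> \<Omega> \<Longrightarrow> cmod (\<Phi> (Complex x (- \<omega>))) = cmod (\<Gamma> (Complex x (- \<omega>)))"
  shows "\<exists>c. cmod c = 1 \<and> (\<forall>z. \<Phi> z = c * \<Gamma> z)"
proof -
  define D where "D = (\<lambda>a b z. \<Phi> (a + b * z) * cnj (\<Phi> (a + b * cnj z))
                              - \<Gamma> (a + b * z) * cnj (\<Gamma> (a + b * cnj z)))"
  have holD: "D a b holomorphic_on UNIV" for a b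
    unfolding D_def by (intro holomorphic_on_diff holomorphic_mult_cnj_reflection hol)
  have D_real: "D a b (of_real x) = 0 \<longleftrightarrow> cmod (\<Phi> (a + b * of_real x)) = cmod (\<Gamma> (a + b * of_real x))" for a b x
  proof -
    have "D a b (of_real x) = of_real ((cmod (\<Phi> (a + b * of_real x)))\<^sup>2 - (cmod (\<Gamma> (a + b * of_real x)))\<^sup>2)"
      by (simp only: D_def complex_cnj_complex_of_real complex_norm_square of_real_diff)
    then show ?thesis
      by (simp del: of_real_diff of_real_power)
  qed
  have C: "C \<ge> 0" using order_trans[OF norm_ge_zero bound(1)[of 0]] by simp
  have D_bound: "cmod (D a b z) \<le> 2 * (C * exp (\<beta> * m))\<^sup>2"
    if m: "\<bar>Im (a + b * z)\<bar> \<le> m" "\<bar>Im (a + b * cnj z)\<bar> \<le> m" for a b z m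
  proof -
    have le: "C * exp (\<beta> * y) \<le> C * exp (\<beta> * m)" if "y \<le> m" for y
      using that C \<open>\<beta> \<ge> 0\<close> by (intro mult_left_mono) (auto intro: mult_left_mono)
    have "cmod (D a b z) \<le> cmod (\<Phi> (a + b * z)) * cmod (\<Phi> (a + b * cnj z))
                         + cmod (\<Gamma> (a + b * z)) * cmod (\<Gamma> (a + b * cnj z))"
      unfolding D_def by (rule order_trans[OF norm_triangle_ineq4]) (simp add: norm_mult)
    also have "\<dots> \<le> (C * exp (\<beta> * m)) * (C * exp (\<beta> * m)) + (C * exp (\<beta> * m)) * (C * exp (\<beta> * m))"
      using C m by (intro add_mono mult_mono order_trans[OF bound(1) le] order_trans[OF bound(2) le]) auto
    finally show ?thesis by (simp only: power2_eq_square mult_2)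
  qed
  have exp_sq: "2 * (C * exp (\<beta> * (u + v)))\<^sup>2 = 2 * C\<^sup>2 * exp (2 * \<beta> * u) * exp (2 * \<beta> * v)" for u v
    by (simp add: power_mult_distrib exp_double[symmetric] mult.assoc distrib_left exp_add)
  have vertical: "cmod (\<Phi> (Complex x (- \<omega>))) = cmod (\<Gamma> (Complex x (- \<omega>)))" if "\<omega> \<in> \<Omega>" for x \<omega>
  proof -
    have pt: "- (\<i> * of_real \<omega>) + 1 * of_real y = Complex y (- \<omega>)" for y
      by (simp add: complex_eq_iff)
    have "D (- (\<i> * of_real \<omega>)) 1 (of_real x) = 0"
    proof (rule exponential_type_eq_0_if_zeros_dense[OF holD, where \<tau> = "2 * \<beta>"])
      show "cmod (D (- (\<i> * of_real \<omega>)) 1 z) \<le> 2 * C\<^sup>2 * exp (2 * \<beta> * \<bar>\<omega>\<bar>) * exp (2 * \<beta> * \<bar>Im z\<bar>)" for z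
        unfolding exp_sq[symmetric] by (rule D_bound) auto
      show "D (- (\<i> * of_real \<omega>)) 1 (of_real y) = 0" if "y \<in> X" for y
        unfolding D_real pt using eq that \<open>\<omega> \<in> \<Omega>\<close> by simp
    qed (use r fin \<open>\<beta> \<ge> 0\<close> in auto)
    then show ?thesis unfolding D_real pt .
  qed
  have everywhere: "cmod (\<Phi> (Complex x (- \<omega>))) = cmod (\<Gamma> (Complex x (- \<omega>)))" for x \<omega>
  proof -
    have pt: "of_real x + - \<i> * of_real y = Complex x (- y)" for y
      by (simp add: complex_eq_iff)
    have "D (of_real x) (- \<i>) (of_real \<omega>) = 0"
    proof (rule eq_0_if_reciprocal_zeros_not_summable[OF holD _ _ div, where \<tau> = "2 * \<beta>"])
      show "cmod (D (of_real x) (- \<i>) z) \<le> 2 * C\<^sup>2 * exp (2 * \<beta> * 0) * exp (2 * \<beta> * \<bar>Re z\<bar>)" for z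
        unfolding exp_sq[symmetric] by (rule D_bound) auto
      show "D (of_real x) (- \<i>) (of_real y) = 0" if "y \<in> \<Omega>" for y
        unfolding D_real pt by (rule vertical[OF that])
    qed
    then show ?thesis unfolding D_real pt .
  qed
  show ?thesis
    by (rule entire_eq_norm_imp_unimodular_multiple[OF hol])
       (metis complex_surj everywhere minus_minus)
qed

section \<open>Existence of the lower uniform density\<close>

lemma separated_interval_count:
  fixes X :: "real set"
  assumes sep: "\<And>x y. x \<in> X \<Longrightarrow> y \<in> X \<Longrightarrow> dist x y < e \<Longrightarrow> x = y" and "e > 0"
  shows "finite (X \<inter> {t..t + r})" and "r \<ge> 0 \<Longrightarrow> real (card (X \<inter> {t..t + r})) \<le> r / e + 1"
proof -
  define \<phi> where "\<phi> = (\<lambda>x. \<lfloor>(x - t) / e\<rfloor>)"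
  have inj: "inj_on \<phi> (X \<inter> {t..t + r})"
  proof (rule inj_onI)
    fix x y assume xy: "x \<in> X \<inter> {t..t + r}" "y \<in> X \<inter> {t..t + r}" "\<phi> x = \<phi> y"
    have "\<bar>(x - t) / e - (y - t) / e\<bar> < 1"
      using xy(3) unfolding \<phi>_def by linarith
    also have "(x - t) / e - (y - t) / e = (x - y) / e" by (simp add: diff_divide_distrib)
    finally have "dist x y < e" using \<open>e > 0\<close> by (simp add: dist_real_def field_simps)
    then show "x = y" using sep xy by blast
  qed
  have image: "\<phi> ` (X \<inter> {t..t + r}) \<subseteq> {0..\<lfloor>r / e\<rfloor>}"
    using \<open>e > 0\<close> by (auto simp: \<phi>_def intro!: floor_mono divide_right_mono)
  then show "finite (X \<inter> {t..t + r})"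
    using inj by (meson finite_atLeastAtMost_int finite_imageD finite_subset)
  assume "r \<ge> 0"
  have "card (X \<inter> {t..t + r}) \<le> card {0..\<lfloor>r / e\<rfloor>}"
    using image inj by (metis card_image card_mono finite_atLeastAtMost_int)
  also have "\<dots> = nat (\<lfloor>r / e\<rfloor> + 1)" by simp
  finally have "real (card (X \<inter> {t..t + r})) \<le> real (nat (\<lfloor>r / e\<rfloor> + 1))"
    by (rule of_nat_mono)
  also have "\<dots> \<le> r / e + 1"
    using \<open>r \<ge> 0\<close> \<open>e > 0\<close> by simp
  finally show "real (card (X \<inter> {t..t + r})) \<le> r / e + 1" .
qed

lemma min_count_le: "min_count X r \<le> card (X \<inter> {t..t + r})"
  unfolding min_count_def by (rule cINF_lower) auto

lemma min_count_greatest: "(\<And>t. m \<le> card (X \<inter> {t..t + r})) \<Longrightarrow> m \<le> min_count X r"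
  unfolding min_count_def by (rule cINF_greatest) auto

lemma min_count_mono:
  assumes "\<And>a b. finite (X \<inter> {a..b})" "r \<le> s"
  shows "min_count X r \<le> min_count X s"
proof (rule min_count_greatest)
  fix t
  have "min_count X r \<le> card (X \<inter> {t..t + r})" by (rule min_count_le)
  also have "\<dots> \<le> card (X \<inter> {t..t + s})"
    using assms by (intro card_mono) auto
  finally show "min_count X r \<le> card (X \<inter> {t..t + s})" .
qed

text \<open>
  The correction by \<open>1\<close> accounts for the common endpoint of two adjacent closed intervals.
\<close>

lemma min_count_superadditive:
  assumes "\<And>a b. finite (X \<inter> {a..b})" "r \<ge> 0" "s \<ge> 0"
  shows "min_count X r + min_count X s \<le> min_count X (r + s) + 1"
proof -
  have "min_count X r + min_count X s - 1 \<le> min_count X (r + s)"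
  proof (rule min_count_greatest)
    fix t
    let ?I = "X \<inter> {t..t + r}" and ?J = "X \<inter> {t + r..t + r + s}"
    have "card ?I + card ?J = card (?I \<union> ?J) + card (?I \<inter> ?J)"
      using assms(1) by (intro card_Un_Int)
    moreover have "card (?I \<inter> ?J) \<le> card {t + r}"
      by (intro card_mono) auto
    moreover have "card (?I \<union> ?J) \<le> card (X \<inter> {t..t + (r + s)})"
      using assms by (intro card_mono) auto
    moreover have "min_count X r \<le> card ?I" "min_count X s \<le> card ?J"
      by (rule min_count_le)+
    ultimately show "min_count X r + min_count X s - 1 \<le> card (X \<inter> {t..t + (r + s)})"
      by simp
  qed
  then show ?thesis by simp
qed

lemma min_count_multiple:
  assumes "\<And>a b. finite (X \<inter> {a..b})" "r \<ge> 0"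
  shows "k * (min_count X r - 1) \<le> min_count X (real k * r)"
proof (induction k)
  case (Suc k)
  have "real k * r \<ge> 0" using assms by simp
  have "min_count X (real k * r) + min_count X r \<le> min_count X (real k * r + r) + 1"
    by (rule min_count_superadditive) (use assms \<open>real k * r \<ge> 0\<close> in auto)
  moreover have "real k * r + r = real (Suc k) * r" by (simp add: algebra_simps)
  ultimately show ?case using Suc by simp
qed simp

text \<open>
  Fekete's argument: \<open>min_count X r - 1\<close> is superadditive, so its quotient by \<open>r\<close> tends to its
  supremum, which is finite by separation. Convergence has to be established before anything can be
  concluded from \<open>lower_uniform_density X\<close>, as \<open>Lim\<close> is a definite description.
\<close>

lemma min_count_density_converges:
  assumes "uniform_discrete X"
  shows "\<exists>L. ((\<lambda>r. real (min_count X r) / r) \<longlongrightarrow> L) at_top"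
proof -
  obtain e where e: "e > 0" "\<And>x y. x \<in> X \<Longrightarrow> y \<in> X \<Longrightarrow> dist x y < e \<Longrightarrow> x = y"
    using assms by (auto simp: uniform_discrete_def)
  have fin: "finite (X \<inter> {a..b})" for a b
    using separated_interval_count(1)[of X e a "b - a"] e by simp
  define q where "q = (\<lambda>r. real (min_count X r - 1) / r)"
  define L where "L = (SUP r\<in>{0<..}. q r)"
  have "q r \<le> 1 / e" if "r > 0" for r
  proof -
    have "real (min_count X r) \<le> r / e + 1"
    proof -
      have "real (min_count X r) \<le> real (card (X \<inter> {0..0 + r}))"
        by (intro of_nat_mono min_count_le)
      also have "\<dots> \<le> r / e + 1"
        by (rule separated_interval_count(2)[OF e(2)]) (use e that in auto)
      finally show ?thesis .
    qed
    then have "real (min_count X r - 1) \<le> r / e"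
      using that e by (cases "min_count X r") auto
    then show ?thesis using that by (simp add: q_def field_simps)
  qed
  then have bdd: "bdd_above (q ` {0<..})"
    by (intro bdd_aboveI2[of _ _ "1 / e"]) auto
  have "((\<lambda>r. real (min_count X r) / r) \<longlongrightarrow> L) at_top"
  proof (rule order_tendstoI)
    fix a assume "a < L"
    then obtain r0 where r0: "r0 > 0" "a < q r0"
      unfolding L_def using less_cSUP_iff[OF _ bdd] by auto
    have "((\<lambda>r. (r / r0 - 1) * real (min_count X r0 - 1) / r) \<longlongrightarrow> q r0) at_top"
    proof -
      define C where "C = real (min_count X r0 - 1)"
      have "((\<lambda>r. (r / r0 - 1) * C / r) \<longlongrightarrow> inverse r0 * C) at_top"
        using r0 by real_asymp
      then show ?thesis by (simp add: C_def q_def divide_inverse mult_ac)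
    qed
    then have "\<forall>\<^sub>F r in at_top. a < (r / r0 - 1) * real (min_count X r0 - 1) / r"
      using r0 by (intro order_tendstoD) auto
    then show "\<forall>\<^sub>F r in at_top. a < real (min_count X r) / r"
      using eventually_gt_at_top[of 0]
    proof eventually_elim
      case (elim r)
      define k where "k = nat \<lfloor>r / r0\<rfloor>"
      have k: "r / r0 - 1 \<le> real k" "real k \<le> r / r0"
        using elim r0 by (auto simp: k_def)
      have "real k * real (min_count X r0 - 1) = real (k * (min_count X r0 - 1))" by simp
      also have "\<dots> \<le> real (min_count X (real k * r0))"
        using min_count_multiple[of X r0 k] fin r0 by (intro of_nat_mono) auto
      also have "\<dots> \<le> real (min_count X r)"
        using k r0 by (intro of_nat_mono min_count_mono fin) (simp add: field_simps)
      finally have "(r / r0 - 1) * real (min_count X r0 - 1) \<le> real (min_count X r)"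
        using k by (meson mult_right_mono of_nat_0_le_iff order_trans)
      then have "(r / r0 - 1) * real (min_count X r0 - 1) / r \<le> real (min_count X r) / r"
        using elim by (intro divide_right_mono) auto
      then show ?case using elim by linarith
    qed
  next
    fix a assume "L < a"
    moreover have "((\<lambda>r. L + 1 / r) \<longlongrightarrow> L) at_top" by real_asymp
    ultimately have "\<forall>\<^sub>F r in at_top. L + 1 / r < a"
      by (intro order_tendstoD) auto
    then show "\<forall>\<^sub>F r in at_top. real (min_count X r) / r < a"
      using eventually_gt_at_top[of 0]
    proof eventually_elim
      case (elim r)
      have "real (min_count X r) / r \<le> (real (min_count X r - 1) + 1) / r"
        using elim by (intro divide_right_mono) auto
      also have "\<dots> = q r + 1 / r" by (simp add: q_def add_divide_distrib)
      also have "q r \<le> L"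
        unfolding L_def using elim by (intro cSUP_upper bdd) auto
      finally show ?case using elim by linarith
    qed
  qed
  then show ?thesis by blast
qed

lemma lower_uniform_density_gt_imp_count:
  assumes "uniform_discrete X" "lower_uniform_density X > c"
  shows "\<exists>r>0. c * r < real (min_count X r)"
proof -
  obtain L where L: "((\<lambda>r. real (min_count X r) / r) \<longlongrightarrow> L) at_top"
    using min_count_density_converges[OF assms(1)] by blast
  then have "lower_uniform_density X = L"
    unfolding lower_uniform_density_def by (intro tendsto_Lim) auto
  then have "\<forall>\<^sub>F r in at_top. c < real (min_count X r) / r"
    using assms(2) by (intro order_tendstoD[OF L]) auto
  then have "\<forall>\<^sub>F r in at_top. r > 0 \<and> c * r < real (min_count X r)"
    using eventually_gt_at_top[of 0] by eventually_elim (simp add: field_simps)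
  then show ?thesis
    using eventually_happens' trivial_limit_at_top_linorder by blast
qed

section \<open>Gaussian wave packets as Schwartz functions\<close>

definition gaussian_wave :: "real \<Rightarrow> real \<Rightarrow> real \<Rightarrow> real \<Rightarrow> complex" where
  "gaussian_wave a x \<omega> t = of_real (exp (- pi * a * (t - x)\<^sup>2)) *
     exp (- 2 * complex_of_real pi * \<i> * of_real t * of_real \<omega>)"

lemma norm_gaussian_wave: "cmod (gaussian_wave a x \<omega> t) = exp (- pi * a * (t - x)\<^sup>2)"
  by (simp add: gaussian_wave_def norm_mult)

lemma poly_exponential_growth:
  fixes p :: "complex poly"
  shows "\<exists>c n. c \<ge> 0 \<and> (\<forall>t::real. cmod (poly p (of_real t)) \<le> c * exp (real n * \<bar>t\<bar>))"
proof (induction p)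
  case 0
  show ?case by (intro exI[of _ 0]) simp
next
  case (pCons a p)
  then obtain c n where c: "c \<ge> 0" "\<And>t::real. cmod (poly p (of_real t)) \<le> c * exp (real n * \<bar>t\<bar>)"
    by blast
  have "cmod (poly (pCons a p) (of_real t)) \<le> (cmod a + c) * exp (real (Suc n) * \<bar>t\<bar>)" for t :: real
  proof -
    have "\<bar>t\<bar> \<le> exp \<bar>t\<bar>"
      using exp_ge_add_one_self[of "\<bar>t\<bar>"] by linarith
    then have "\<bar>t\<bar> * cmod (poly p (of_real t)) \<le> exp \<bar>t\<bar> * (c * exp (real n * \<bar>t\<bar>))"
      using c by (intro mult_mono) auto
    also have "\<dots> = c * exp (real (Suc n) * \<bar>t\<bar>)"
      by (simp add: exp_add[symmetric] algebra_simps)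
    finally have "\<bar>t\<bar> * cmod (poly p (of_real t)) \<le> c * exp (real (Suc n) * \<bar>t\<bar>)" .
    moreover have "cmod a * 1 \<le> cmod a * exp (real (Suc n) * \<bar>t\<bar>)"
      by (intro mult_left_mono) auto
    moreover have "cmod (poly (pCons a p) (of_real t)) \<le> cmod a + \<bar>t\<bar> * cmod (poly p (of_real t))"
      using norm_triangle_ineq[of a "of_real t * poly p (of_real t)"] by (simp add: norm_mult)
    ultimately show ?thesis by (simp add: distrib_right)
  qed
  then show ?case using c(1) by (intro exI[of _ "cmod a + c"] exI[of _ "Suc n"]) simp
qed

text \<open>
  The \<open>n\<close>-th derivative is a polynomial times the function itself, and a polynomial grows at most
  exponentially.
\<close>

lemma gaussian_wave_schwartz:
  assumes "a > 0"
  shows "gaussian_wave a x \<omega> \<in> schwartz"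
proof -
  define E where "E = (\<lambda>z::complex. exp (- of_real (pi * a) * (z - of_real x)\<^sup>2 - 2 * of_real pi * \<i> * z * of_real \<omega>))"
  define q where "q = [: of_real (2 * pi * a * x) - 2 * of_real pi * \<i> * of_real \<omega>, - of_real (2 * pi * a) :]"
  define P where "P = (\<lambda>n. ((\<lambda>p. pderiv p + p * q) ^^ n) 1)"
  define D where "D = (\<lambda>n t. poly (P n) (of_real t) * E (of_real t))"
  have E_wave: "E (of_real t) = gaussian_wave a x \<omega> t" for t
  proof -
    have "- of_real (pi * a) * (of_real t - of_real x)\<^sup>2 - 2 * of_real pi * \<i> * of_real t * of_real \<omega>
        = complex_of_real (- pi * a * (t - x)\<^sup>2) + - 2 * of_real pi * \<i> * of_real t * of_real \<omega>"
      by simp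
    then show ?thesis
      unfolding E_def gaussian_wave_def by (simp only: exp_add exp_of_real)
  qed
  have dE: "(E has_field_derivative poly q z * E z) (at z)" for z
    unfolding E_def q_def by (rule derivative_eq_intros refl | simp)+ (simp add: algebra_simps)
  have "(D n has_vector_derivative D (Suc n) t) (at t)" for n t
  proof -
    have "((\<lambda>z. poly (P n) z * E z) has_field_derivative
            poly (pderiv (P n)) z * E z + poly (P n) z * (poly q z * E z)) (at z)" for z
      by (rule derivative_eq_intros poly_DERIV dE refl | simp add: algebra_simps)+
    moreover have "poly (P (Suc n)) z * E z = poly (pderiv (P n)) z * E z + poly (P n) z * (poly q z * E z)" for z
      by (simp add: P_def algebra_simps)
    ultimately have "((\<lambda>z. poly (P n) z * E z) has_field_derivative poly (P (Suc n)) z * E z) (at z)" for z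
      by simp
    then show ?thesis
      unfolding D_def by (rule has_vector_derivative_real_field)
  qed
  moreover have "D 0 = gaussian_wave a x \<omega>"
    by (simp add: D_def P_def E_wave fun_eq_iff)
  moreover have "bounded (range (\<lambda>t. t ^ m *\<^sub>R D n t))" for m n
  proof -
    obtain c k where c: "c \<ge> 0" "\<And>t::real. cmod (poly (monom 1 m * P n) (of_real t)) \<le> c * exp (real k * \<bar>t\<bar>)"
      using poly_exponential_growth by blast
    have "cmod (t ^ m *\<^sub>R D n t) \<le> c * exp (real k * \<bar>x\<bar> + (real k)\<^sup>2 / (4 * (pi * a)))" for t
    proof -
      define u where "u = \<bar>t - x\<bar>"
      have "cmod (t ^ m *\<^sub>R D n t) = cmod (poly (monom 1 m * P n) (of_real t)) * exp (- pi * a * (t - x)\<^sup>2)"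
        by (simp add: D_def E_wave norm_gaussian_wave norm_mult poly_monom norm_power power_abs)
      also have "\<dots> \<le> c * exp (real k * \<bar>t\<bar>) * exp (- pi * a * (t - x)\<^sup>2)"
        using c by (intro mult_right_mono) auto
      also have "\<dots> = c * exp (real k * \<bar>t\<bar> - pi * a * u\<^sup>2)"
        by (simp add: mult.assoc exp_add[symmetric] u_def)
      also have "\<dots> \<le> c * exp (real k * \<bar>x\<bar> + (real k)\<^sup>2 / (4 * (pi * a)))"
      proof -
        have "real k * \<bar>t\<bar> \<le> real k * (\<bar>x\<bar> + u)"
          unfolding u_def by (intro mult_left_mono) auto
        moreover have "real k * u - pi * a * u\<^sup>2 \<le> (real k)\<^sup>2 / (4 * (pi * a))"
        proof -
          define b where "b = pi * a"
          have b: "b > 0" using assms by (simp add: b_def)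
          have "0 \<le> (real k - 2 * b * u)\<^sup>2" by simp
          then have "(real k * u - b * u\<^sup>2) * (4 * b) \<le> (real k)\<^sup>2"
            by (simp add: power2_eq_square algebra_simps)
          then show ?thesis using b by (simp add: b_def[symmetric] pos_le_divide_eq)
        qed
        ultimately have "real k * \<bar>t\<bar> - pi * a * u\<^sup>2 \<le> real k * \<bar>x\<bar> + (real k)\<^sup>2 / (4 * (pi * a))"
          by (simp add: algebra_simps)
        then show ?thesis using c(1) by (intro mult_left_mono) auto
      qed
      finally show ?thesis .
    qed
    then show ?thesis by (intro boundedI) auto
  qed
  ultimately show ?thesis unfolding schwartz_def by blast
qed

text \<open>
  The substitution \<open>t = x + c y\<close> with \<open>c = 1 / sqrt (2 \<pi> a)\<close> reduces this to the characteristic function of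
  the standard normal distribution.
\<close>

lemma fourier_gaussian_wave:
  assumes "a > 0"
  shows "fourier (gaussian_wave a x \<omega>) \<xi> = of_real (1 / sqrt a * exp (- pi * (\<xi> + \<omega>)\<^sup>2 / a)) *
           exp (- 2 * of_real pi * \<i> * of_real x * of_real (\<xi> + \<omega>))"
proof -
  define c where "c = 1 / sqrt (2 * pi * a)"
  define \<eta> where "\<eta> = \<xi> + \<omega>"
  have c: "c > 0" "c\<^sup>2 = 1 / (2 * pi * a)"
    using assms by (auto simp: c_def power_divide)
  have char: "(LINT y|lborel. std_normal_density y *\<^sub>R iexp (s * y)) = of_real (exp (- s\<^sup>2 / 2))" for s
  proof -
    have "char std_normal_distribution s = (LINT y|lborel. std_normal_density y *\<^sub>R iexp (s * y))"
      unfolding char_def by (subst integral_density) auto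
    then show ?thesis by (simp add: char_std_normal_distribution)
  qed
  have "fourier (gaussian_wave a x \<omega>) \<xi> =
      (LINT t|lborel. of_real (exp (- pi * a * (t - x)\<^sup>2)) * exp (- 2 * of_real pi * \<i> * of_real t * of_real \<eta>))"
    unfolding fourier_def gaussian_wave_def \<eta>_def
    by (intro Bochner_Integration.integral_cong)
       (auto simp: exp_add[symmetric] mult.assoc algebra_simps)
  also have "\<dots> = c *\<^sub>R (LINT y|lborel. of_real (exp (- pi * a * (x + c * y - x)\<^sup>2)) *
      exp (- 2 * of_real pi * \<i> * of_real (x + c * y) * of_real \<eta>))"
    using c by (subst lborel_integral_real_affine[of c _ x]) auto
  also have "\<dots> = c *\<^sub>R (LINT y|lborel. (of_real (sqrt (2 * pi)) * exp (- 2 * of_real pi * \<i> * of_real x * of_real \<eta>)) *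
      (std_normal_density y *\<^sub>R iexp ((- 2 * pi * c * \<eta>) * y)))"
  proof (intro arg_cong[where f = "(*\<^sub>R) c"] Bochner_Integration.integral_cong refl)
    fix y
    have "- pi * a * (x + c * y - x)\<^sup>2 = - y\<^sup>2 / 2"
      using assms by (simp add: power_mult_distrib c)
    then have 1: "exp (- pi * a * (x + c * y - x)\<^sup>2) = sqrt (2 * pi) * std_normal_density y"
      by (simp add: std_normal_density_def)
    have "- 2 * of_real pi * \<i> * of_real (x + c * y) * of_real \<eta> =
        - 2 * of_real pi * \<i> * of_real x * of_real \<eta> + \<i> * complex_of_real ((- 2 * pi * c * \<eta>) * y)"
      by (simp add: algebra_simps)
    then have 2: "exp (- 2 * of_real pi * \<i> * of_real (x + c * y) * of_real \<eta>) =
        exp (- 2 * of_real pi * \<i> * of_real x * of_real \<eta>) * iexp ((- 2 * pi * c * \<eta>) * y)"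
      by (simp only: exp_add)
    show "of_real (exp (- pi * a * (x + c * y - x)\<^sup>2)) * exp (- 2 * of_real pi * \<i> * of_real (x + c * y) * of_real \<eta>) =
        (of_real (sqrt (2 * pi)) * exp (- 2 * of_real pi * \<i> * of_real x * of_real \<eta>)) *
        (std_normal_density y *\<^sub>R iexp ((- 2 * pi * c * \<eta>) * y))"
      unfolding 1 2 by (simp only: of_real_mult scaleR_conv_of_real mult_ac)
  qed
  also have "\<dots> = c *\<^sub>R ((of_real (sqrt (2 * pi)) * exp (- 2 * of_real pi * \<i> * of_real x * of_real \<eta>)) *
      of_real (exp (- (- 2 * pi * c * \<eta>)\<^sup>2 / 2)))"
    by (simp only: integral_mult_right_zero char)
  also have "- (- 2 * pi * c * \<eta>)\<^sup>2 / 2 = - pi * \<eta>\<^sup>2 / a"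
    using assms by (simp add: power_mult_distrib c power2_eq_square[of pi])
  also have "c *\<^sub>R ((of_real (sqrt (2 * pi)) * exp (- 2 * of_real pi * \<i> * of_real x * of_real \<eta>)) *
      of_real (exp (- pi * \<eta>\<^sup>2 / a))) =
      of_real (c * sqrt (2 * pi) * exp (- pi * \<eta>\<^sup>2 / a)) * exp (- 2 * of_real pi * \<i> * of_real x * of_real \<eta>)"
    by (simp only: of_real_mult scaleR_conv_of_real mult_ac)
  also have "c * sqrt (2 * pi) = 1 / sqrt a"
    by (simp add: c_def real_sqrt_mult)
  finally show ?thesis by (simp add: \<eta>_def)
qed

section \<open>Paley-Wiener functions and their spectra\<close>

lemma Lp_interval_integrable:
  assumes "1 \<le> p" "F \<in> Lp_interval p B"
  shows "integrable lborel F"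
proof -
  have [measurable]: "F \<in> borel_measurable lborel" and supp: "\<And>t. t \<notin> {-B..B} \<Longrightarrow> F t = 0"
    using assms(2) by (auto simp: Lp_interval_def)
  have int1: "integrable lborel (\<lambda>t. indicator {-B..B} t *\<^sub>R c)" for c :: real
    by (intro integrable_indicator integrable_scaleR_left) (auto simp: emeasure_lborel_Icc_eq)
  show ?thesis
  proof (cases "p = \<infinity>")
    case True
    then obtain C where C: "AE t in lborel. cmod (F t) \<le> C"
      using assms(2) by (auto simp: Lp_interval_def)
    show ?thesis
    proof (rule Bochner_Integration.integrable_bound[OF int1[of C]])
      show "AE t in lborel. cmod (F t) \<le> norm (indicator {-B..B} t *\<^sub>R C)"
        using C
      proof eventually_elim
        case (elim t)
        then show ?case using supp[of t] by (auto simp: indicator_def)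
      qed
    qed simp
  next
    case False
    then have Fp: "integrable lborel (\<lambda>t. cmod (F t) powr enn2real p)"
      using assms(2) by (auto simp: Lp_interval_def)
    have p: "enn2real p \<ge> 1"
      using assms(1) False enn2real_mono[of 1 p] by (auto simp: less_top)
    show ?thesis
    proof (rule Bochner_Integration.integrable_bound[OF Bochner_Integration.integrable_add[OF int1[of 1] Fp]])
      show "AE t in lborel. cmod (F t) \<le> norm (indicator {-B..B} t *\<^sub>R 1 + cmod (F t) powr enn2real p)"
      proof (rule AE_I2)
        fix t
        have "cmod (F t) \<le> indicator {-B..B} t + cmod (F t) powr enn2real p"
        proof (cases "t \<in> {-B..B}")
          case True
          have "cmod (F t) \<le> 1 + cmod (F t) powr enn2real p"
          proof (cases "cmod (F t) \<le> 1")
            case False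
            then have "cmod (F t) powr 1 \<le> cmod (F t) powr enn2real p"
              using p by (intro powr_mono) auto
            then show ?thesis using False by simp
          qed (simp add: add_increasing2)
          then show ?thesis using True by simp
        qed (simp add: supp)
        then show "cmod (F t) \<le> norm (indicator {-B..B} t *\<^sub>R 1 + cmod (F t) powr enn2real p)"
          by simp
      qed
    qed simp
  qed
qed

text \<open>
  Testing the distributional identity against Gaussians of width \<open>1/n\<close> centred at \<open>x\<close>, normalised to
  integral \<open>1\<close>, gives \<open>f x\<close> on one side and the Fourier integral on the other as \<open>n\<close> grows. Since the Fourier
  transforms of these Gaussians are explicit, dominated convergence suffices on both sides and no
  interchange of integrals occurs.
\<close>

lemma eq_fourier_if_distr_eq:
  assumes cont: "continuous_on UNIV f" and bdd: "bounded (range f)"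
    and F: "integrable lborel F"
    and eq: "\<And>\<phi>. \<phi> \<in> schwartz \<Longrightarrow> regular_distr f \<phi> = distr_fourier (regular_distr F) \<phi>"
  shows "f x = fourier F x"
proof -
  have [measurable]: "f \<in> borel_measurable borel"
    using cont by (rule borel_measurable_continuous_onI)
  have [measurable]: "F \<in> borel_measurable borel"
    using F by auto
  obtain M where M: "\<And>t. cmod (f t) \<le> M"
    using bdd by (auto simp: bounded_iff)
  have gauss: "exp (- pi * y\<^sup>2) = normal_density 0 (1 / sqrt (2 * pi)) y" for y
    by (simp add: normal_density_def power_divide)
  define I where "I = (\<lambda>n. LINT y|lborel. f (x + y / real (Suc n)) * of_real (exp (- pi * y\<^sup>2)))"
  define J where "J = (\<lambda>n. LINT \<xi>|lborel. F \<xi> * (of_real (exp (- pi * \<xi>\<^sup>2 / (real (Suc n))\<^sup>2)) *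
           exp (- 2 * of_real pi * \<i> * of_real x * of_real \<xi>)))"
  have "I n = J n" for n
  proof -
    define N where "N = real (Suc n)"
    have N: "N > 0" by (simp add: N_def)
    have "regular_distr f (gaussian_wave (N\<^sup>2) x 0) = distr_fourier (regular_distr F) (gaussian_wave (N\<^sup>2) x 0)"
      using N by (intro eq gaussian_wave_schwartz) simp
    moreover have "regular_distr f (gaussian_wave (N\<^sup>2) x 0) = (1 / N) *\<^sub>R I n"
      unfolding regular_distr_def
      using N by (subst lborel_integral_real_affine[of "1 / N" _ x])
        (auto simp: I_def gaussian_wave_def N_def[symmetric] power_divide simp del: of_nat_Suc)
    moreover have "distr_fourier (regular_distr F) (gaussian_wave (N\<^sup>2) x 0) = (1 / N) *\<^sub>R J n"
    proof -
      have "distr_fourier (regular_distr F) (gaussian_wave (N\<^sup>2) x 0) =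
          (LINT \<xi>|lborel. (1 / N) *\<^sub>R (F \<xi> * (of_real (exp (- pi * \<xi>\<^sup>2 / (real (Suc n))\<^sup>2)) *
           exp (- 2 * of_real pi * \<i> * of_real x * of_real \<xi>))))"
        unfolding distr_fourier_def regular_distr_def
        using N by (simp add: fourier_gaussian_wave N_def[symmetric] scaleR_conv_of_real mult_ac del: of_nat_Suc)
      then show ?thesis by (simp only: J_def integral_scaleR_right)
    qed
    ultimately show ?thesis using N by simp
  qed
  moreover have "I \<longlonglongrightarrow> (LINT y|lborel. f x * of_real (exp (- pi * y\<^sup>2)))"
    unfolding I_def
  proof (rule integral_dominated_convergence[where w = "\<lambda>y. M * exp (- pi * y\<^sup>2)"])
    show "integrable lborel (\<lambda>y. M * exp (- pi * y\<^sup>2))"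
      unfolding gauss by (intro integrable_mult_right) auto
    show "AE y in lborel. (\<lambda>n. f (x + y / real (Suc n)) * of_real (exp (- pi * y\<^sup>2)))
            \<longlonglongrightarrow> f x * of_real (exp (- pi * y\<^sup>2))"
    proof (intro AE_I2 tendsto_mult tendsto_const)
      fix y
      have "isCont f x" using cont by (simp add: continuous_on_eq_continuous_at)
      moreover have "(\<lambda>n. x + y / real (Suc n)) \<longlonglongrightarrow> x" by real_asymp
      ultimately show "(\<lambda>n. f (x + y / real (Suc n))) \<longlonglongrightarrow> f x"
        by (rule isCont_tendsto_compose)
    qed
    show "AE y in lborel. norm (f (x + y / real (Suc n)) * of_real (exp (- pi * y\<^sup>2))) \<le> M * exp (- pi * y\<^sup>2)" for n
      using M by (intro AE_I2) (auto simp: norm_mult intro!: mult_right_mono)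
  qed auto
  moreover have "(LINT y|lborel. f x * of_real (exp (- pi * y\<^sup>2))) = f x"
  proof -
    have "(LINT y|lborel. f x * of_real (exp (- pi * y\<^sup>2))) = f x * of_real (LINT y|lborel. exp (- pi * y\<^sup>2))"
      by simp
    also have "(LINT y|lborel. exp (- pi * y\<^sup>2)) = 1"
      unfolding gauss by (rule integral_normal_density) simp
    finally show ?thesis by simp
  qed
  moreover have "J \<longlonglongrightarrow> fourier F x"
    unfolding J_def fourier_def
  proof (rule integral_dominated_convergence[where w = "\<lambda>\<xi>. cmod (F \<xi>)"])
    show "AE \<xi> in lborel. (\<lambda>n. F \<xi> * (of_real (exp (- pi * \<xi>\<^sup>2 / (real (Suc n))\<^sup>2)) *
           exp (- 2 * of_real pi * \<i> * of_real x * of_real \<xi>)))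
           \<longlonglongrightarrow> F \<xi> * exp (- 2 * of_real pi * \<i> * of_real \<xi> * of_real x)"
    proof (rule AE_I2)
      fix \<xi>
      have "(\<lambda>n. exp (- pi * \<xi>\<^sup>2 / (real (Suc n))\<^sup>2)) \<longlonglongrightarrow> 1" by real_asymp
      then have "(\<lambda>n. F \<xi> * (of_real (exp (- pi * \<xi>\<^sup>2 / (real (Suc n))\<^sup>2)) *
           exp (- 2 * of_real pi * \<i> * of_real x * of_real \<xi>)))
           \<longlonglongrightarrow> F \<xi> * (of_real 1 * exp (- 2 * of_real pi * \<i> * of_real x * of_real \<xi>))"
        by (intro tendsto_intros)
      then show "(\<lambda>n. F \<xi> * (of_real (exp (- pi * \<xi>\<^sup>2 / (real (Suc n))\<^sup>2)) *
           exp (- 2 * of_real pi * \<i> * of_real x * of_real \<xi>)))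
           \<longlonglongrightarrow> F \<xi> * exp (- 2 * of_real pi * \<i> * of_real \<xi> * of_real x)"
        by (simp add: mult_ac)
    qed
    show "AE \<xi> in lborel. norm (F \<xi> * (of_real (exp (- pi * \<xi>\<^sup>2 / (real (Suc n))\<^sup>2)) *
           exp (- 2 * of_real pi * \<i> * of_real x * of_real \<xi>))) \<le> cmod (F \<xi>)" for n
      by (intro AE_I2) (auto simp: norm_mult intro!: mult_left_le)
  qed (use F in auto)
  ultimately show ?thesis
    by (metis LIMSEQ_unique ext)
qed

text \<open>
  For \<open>f\<close> the Fourier transform of \<open>F\<close>, this is the Gabor transform of \<open>f\<close> at \<open>(Re z, - Im z)\<close> up to an
  explicit nonvanishing factor. It is entire in \<open>z\<close>; up to normalisation it is the Bargmann transform of \<open>F\<close>.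
\<close>

definition bargmann :: "(real \<Rightarrow> complex) \<Rightarrow> complex \<Rightarrow> complex" where
  "bargmann F z = (LINT s|lborel. F s * of_real (exp (- pi * s\<^sup>2)) * exp (- 2 * of_real pi * \<i> * z * of_real s))"

text \<open>
  The Gabor transform is the pairing of \<open>f\<close> with a Gaussian wave packet, hence the pairing of \<open>F\<close> with
  the Fourier transform of that packet.
\<close>

lemma norm_gabor_eq_norm_bargmann:
  assumes "\<And>\<phi>. \<phi> \<in> schwartz \<Longrightarrow> regular_distr f \<phi> = distr_fourier (regular_distr F) \<phi>"
  shows "cmod (gabor f x \<omega>) = 2 powr (1/4) * exp (- pi * \<omega>\<^sup>2) * cmod (bargmann F (Complex x (- \<omega>)))"
proof -
  have "gabor f x \<omega> = of_real (2 powr (1/4)) * regular_distr f (gaussian_wave 1 x \<omega>)"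
    by (simp add: gabor_def regular_distr_def gaussian_wave_def mult.assoc)
  also have "regular_distr f (gaussian_wave 1 x \<omega>) = distr_fourier (regular_distr F) (gaussian_wave 1 x \<omega>)"
    by (intro assms gaussian_wave_schwartz) simp
  also have "\<dots> = (LINT s|lborel. (of_real (exp (- pi * \<omega>\<^sup>2)) * iexp (- 2 * pi * x * \<omega>)) *
        (F s * of_real (exp (- pi * s\<^sup>2)) * exp (- 2 * of_real pi * \<i> * Complex x (- \<omega>) * of_real s)))"
    unfolding distr_fourier_def regular_distr_def
  proof (intro Bochner_Integration.integral_cong refl)
    fix s
    have "complex_of_real (- pi * (s + \<omega>)\<^sup>2) + (- 2 * of_real pi * \<i> * of_real x * of_real (s + \<omega>)) =
        complex_of_real (- pi * \<omega>\<^sup>2) + \<i> * of_real (- 2 * pi * x * \<omega>)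
        + (complex_of_real (- pi * s\<^sup>2) + - 2 * of_real pi * \<i> * Complex x (- \<omega>) * of_real s)"
      by (simp add: complex_eq_iff power2_eq_square algebra_simps)
    from arg_cong[OF this, of exp]
    have "of_real (exp (- pi * (s + \<omega>)\<^sup>2)) * exp (- 2 * of_real pi * \<i> * of_real x * of_real (s + \<omega>)) =
        of_real (exp (- pi * \<omega>\<^sup>2)) * iexp (- 2 * pi * x * \<omega>) *
        (of_real (exp (- pi * s\<^sup>2)) * exp (- 2 * of_real pi * \<i> * Complex x (- \<omega>) * of_real s))"
      by (simp only: exp_add exp_of_real)
    then show "F s * fourier (gaussian_wave 1 x \<omega>) s = (of_real (exp (- pi * \<omega>\<^sup>2)) * iexp (- 2 * pi * x * \<omega>)) *
        (F s * of_real (exp (- pi * s\<^sup>2)) * exp (- 2 * of_real pi * \<i> * Complex x (- \<omega>) * of_real s))"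
      by (simp only: fourier_gaussian_wave[OF zero_less_one] real_sqrt_one div_by_1 mult_1 mult_ac)
  qed
  also have "\<dots> = (of_real (exp (- pi * \<omega>\<^sup>2)) * iexp (- 2 * pi * x * \<omega>)) * bargmann F (Complex x (- \<omega>))"
    unfolding bargmann_def by (rule integral_mult_right_zero)
  finally show ?thesis
    by (simp only: norm_mult norm_of_real norm_exp_i_times abs_exp_cancel) simp
qed

text \<open>
  Integrating a power series against a compactly supported density only involves the moments of the
  density. This yields both that \<open>bargmann F\<close> is entire and that it determines the Fourier transform of \<open>F\<close>.
\<close>

lemma integral_power_series_sums:
  fixes K E :: "_ \<Rightarrow> complex"
  assumes K: "integrable lborel K" and supp: "\<And>s::real. s \<notin> {-B..B} \<Longrightarrow> K s = 0"
    and E: "\<And>w. (\<lambda>n. c n * w ^ n) sums E w"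
  shows "(\<lambda>n. c n * (LINT s|lborel. K s * of_real s ^ n)) sums (LINT s|lborel. K s * E (of_real s))"
proof -
  have [measurable]: "K \<in> borel_measurable borel" using K by auto
  define f where "f = (\<lambda>n s. c n * (K s * of_real s ^ n))"
  have "summable (\<lambda>n. c n * of_real (\<bar>B\<bar> + 1) ^ n)"
    using E sums_summable by blast
  then have abs: "summable (\<lambda>n. norm (c n * of_real \<bar>B\<bar> ^ n))"
    by (rule powser_insidea) simp
  have f_le: "norm (f n s) \<le> norm (c n * of_real \<bar>B\<bar> ^ n) * cmod (K s)" for n s
  proof (cases "s \<in> {-B..B}")
    case True
    then have "\<bar>s\<bar> ^ n \<le> \<bar>B\<bar> ^ n" by (intro power_mono) auto
    then have "cmod (c n) * (cmod (K s) * \<bar>s\<bar> ^ n) \<le> cmod (c n) * (cmod (K s) * \<bar>B\<bar> ^ n)"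
      by (intro mult_left_mono) auto
    then show ?thesis by (simp add: f_def norm_mult norm_power mult_ac)
  qed (simp add: f_def supp)
  have int_f: "integrable lborel (f n)" for n
    by (rule Bochner_Integration.integrable_bound[OF integrable_mult_right[OF integrable_norm[OF K], of "norm (c n * of_real \<bar>B\<bar> ^ n)"]])
       (use f_le in \<open>auto simp: f_def abs_mult\<close>)
  have "(\<lambda>n. integral\<^sup>L lborel (f n)) sums (LINT s|lborel. (\<Sum>n. f n s))"
  proof (rule sums_integral[OF int_f])
    show "AE s in lborel. summable (\<lambda>n. norm (f n s))"
      by (intro AE_I2 summable_comparison_test'[OF summable_mult2[OF abs]]) (use f_le in auto)
    show "summable (\<lambda>n. LINT s|lborel. norm (f n s))"
    proof (rule summable_comparison_test'[OF summable_mult2[OF abs, of "LINT s|lborel. cmod (K s)"]])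
      fix n :: nat
      have "(LINT s|lborel. norm (f n s)) \<le> (LINT s|lborel. norm (c n * of_real \<bar>B\<bar> ^ n) * cmod (K s))"
        using K int_f f_le by (intro integral_mono) auto
      then show "norm (LINT s|lborel. norm (f n s)) \<le> norm (c n * of_real \<bar>B\<bar> ^ n) * (LINT s|lborel. cmod (K s))"
        by simp
    qed
  qed
  moreover have "(\<Sum>n. f n s) = K s * E (of_real s)" for s
    using sums_mult[OF E[of "of_real s"], of "K s"] by (intro sums_unique[symmetric]) (simp add: f_def mult_ac)
  moreover have "integral\<^sup>L lborel (f n) = c n * (LINT s|lborel. K s * of_real s ^ n)" for n
    by (simp add: f_def)
  ultimately show ?thesis by simp
qed

lemma integrable_gaussian_weighted:
  assumes "integrable lborel F"
  shows "integrable lborel (\<lambda>s. F s * complex_of_real (exp (- pi * s\<^sup>2)))"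
proof (rule Bochner_Integration.integrable_bound[OF assms])
  have [measurable]: "F \<in> borel_measurable borel" using assms by auto
  show "(\<lambda>s. F s * complex_of_real (exp (- pi * s\<^sup>2))) \<in> borel_measurable lborel" by simp
qed (auto simp: norm_mult intro!: mult_left_le)

lemma bargmann_power_series:
  assumes "integrable lborel F" "\<And>s. s \<notin> {-B..B} \<Longrightarrow> F s = 0"
  shows "(\<lambda>n. ((- 2 * of_real pi * \<i>) ^ n / fact n *
            (LINT s|lborel. F s * of_real (exp (- pi * s\<^sup>2)) * of_real s ^ n)) * z ^ n) sums bargmann F z"
proof -
  define u where "u = - 2 * complex_of_real pi * \<i>"
  have "(\<lambda>n. (u * z) ^ n / fact n * w ^ n) sums exp (u * z * w)" for w
    using exp_converges[of "u * z * w"] by (simp add: scaleR_conv_of_real power_mult_distrib field_simps)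
  from integral_power_series_sums[OF integrable_gaussian_weighted[OF assms(1)] _ this, of B]
  show ?thesis
    unfolding bargmann_def u_def[symmetric] using assms(2) by (simp add: power_mult_distrib mult_ac)
qed

lemma bargmann_holomorphic:
  assumes "integrable lborel F" "\<And>s. s \<notin> {-B..B} \<Longrightarrow> F s = 0"
  shows "bargmann F holomorphic_on UNIV"
proof -
  have "bargmann F holomorphic_on ball 0 r" for r
    by (rule power_series_holomorphic, unfold diff_zero, rule bargmann_power_series[of F B]) (use assms in auto)
  then have "bargmann F field_differentiable at z" for z
    using holomorphic_on_imp_differentiable_at[of _ "ball 0 (cmod z + 1)" z] by simp
  then show ?thesis by (simp add: holomorphic_on_def field_differentiable_at_within)
qed

lemma norm_bargmann_le:
  assumes F: "integrable lborel F" and supp: "\<And>s. s \<notin> {-B..B} \<Longrightarrow> F s = 0"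
  shows "cmod (bargmann F z) \<le> (LINT s|lborel. cmod (F s)) * exp (2 * pi * B * \<bar>Im z\<bar>)"
proof -
  have "cmod (bargmann F z) \<le> (LINT s|lborel. cmod (F s) * exp (2 * pi * B * \<bar>Im z\<bar>))"
    unfolding bargmann_def
  proof (rule order_trans[OF integral_norm_bound integral_mono'])
    fix s
    show "norm (F s * of_real (exp (- pi * s\<^sup>2)) * exp (- 2 * of_real pi * \<i> * z * of_real s))
        \<le> cmod (F s) * exp (2 * pi * B * \<bar>Im z\<bar>)"
    proof (cases "s \<in> {-B..B}")
      case True
      have "Im z * s \<le> \<bar>Im z\<bar> * \<bar>s\<bar>" by (metis abs_ge_self abs_mult)
      also have "\<dots> \<le> \<bar>Im z\<bar> * B" using True by (intro mult_left_mono) auto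
      finally have "exp (2 * pi * (Im z * s)) \<le> exp (2 * pi * (\<bar>Im z\<bar> * B))"
        by (simp add: mult_left_mono)
      moreover have "exp (- pi * s\<^sup>2) \<le> 1" by simp
      ultimately have "exp (- pi * s\<^sup>2) * exp (2 * pi * (Im z * s)) \<le> 1 * exp (2 * pi * (\<bar>Im z\<bar> * B))"
        by (intro mult_mono) auto
      then have "cmod (F s) * (exp (- pi * s\<^sup>2) * exp (2 * pi * (Im z * s))) \<le> cmod (F s) * exp (2 * pi * (\<bar>Im z\<bar> * B))"
        by (intro mult_left_mono) auto
      then show ?thesis by (simp add: norm_mult mult_ac)
    qed (simp add: supp)
  qed (use F in auto)
  then show ?thesis by simp
qed

text \<open>
  The Taylor coefficients of \<open>bargmann F\<close> are multiples of the moments of \<open>F s exp (- \<pi> s\<^sup>2)\<close>, and the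
  Fourier transform of \<open>F\<close> is a combination of these moments, with the Taylor coefficients of
  \<open>exp (\<pi> w\<^sup>2 - 2 \<pi> \<i> t w)\<close> as weights.
\<close>

lemma fourier_eq_if_bargmann_eq:
  assumes F: "integrable lborel F" "\<And>s. s \<notin> {-B..B} \<Longrightarrow> F s = 0"
    and G: "integrable lborel G" "\<And>s. s \<notin> {-B..B} \<Longrightarrow> G s = 0"
    and eq: "\<And>z. bargmann F z = c * bargmann G z"
  shows "fourier F t = c * fourier G t"
proof -
  define u where "u = - 2 * complex_of_real pi * \<i>"
  define m where "m = (\<lambda>F n. LINT s|lborel. F s * complex_of_real (exp (- pi * s\<^sup>2)) * of_real s ^ n)"
  define a where "a = (\<lambda>n. u ^ n / fact n * (m F n - c * m G n))"
  have sums0: "(\<lambda>n. a n * z ^ n) sums 0" for z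
  proof -
    have "(\<lambda>n. u ^ n / fact n * m F n * z ^ n - c * (u ^ n / fact n * m G n * z ^ n)) sums (bargmann F z - c * bargmann G z)"
      unfolding u_def m_def by (intro sums_diff sums_mult bargmann_power_series F G)
    then show ?thesis by (simp add: a_def eq algebra_simps)
  qed
  have "a n = 0" for n
  proof (rule ccontr)
    assume nz: "a n \<noteq> 0"
    have "a 0 = 0" using sums0[of 0] by simp
    then have "n > 0" using nz by (cases n) auto
    then obtain s where "s > 0" "\<And>z::complex. z \<in> cball 0 s - {0} \<Longrightarrow> (0::complex) \<noteq> 0"
      using powser_0_nonzero[of 1 0 a "\<lambda>_. 0" n] sums0 nz by auto
    then show False by (metis Diff_iff mem_cball_0 norm_of_real abs_of_pos of_real_eq_0_iff order_refl less_irrefl singletonD)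
  qed
  then have moments: "m F n = c * m G n" for n
    by (simp add: a_def u_def)
  define E where "E = (\<lambda>w. exp (of_real pi * w\<^sup>2 - 2 * of_real pi * \<i> * of_real t * w))"
  define e where "e = (\<lambda>n. (deriv ^^ n) E 0 / fact n)"
  have E_sums: "(\<lambda>n. e n * w ^ n) sums E w" for w
  proof -
    have "E holomorphic_on ball 0 (cmod w + 1)"
      unfolding E_def by (intro holomorphic_intros)
    then show ?thesis
      unfolding e_def using holomorphic_power_series[of E 0 "cmod w + 1" w] by simp
  qed
  have fourier_sums: "(\<lambda>n. e n * m A n) sums fourier A t"
    if A: "integrable lborel A" "\<And>s. s \<notin> {-B..B} \<Longrightarrow> A s = 0" for A
  proof -
    have "(\<lambda>n. e n * m A n) sums (LINT s|lborel. A s * of_real (exp (- pi * s\<^sup>2)) * E (of_real s))"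
      unfolding m_def
      by (rule integral_power_series_sums[OF integrable_gaussian_weighted[OF A(1)] _ E_sums]) (use A in auto)
    also have "(LINT s|lborel. A s * of_real (exp (- pi * s\<^sup>2)) * E (of_real s)) = fourier A t"
      unfolding fourier_def
    proof (intro Bochner_Integration.integral_cong refl)
      fix s
      have "of_real (exp (- pi * s\<^sup>2)) * E (of_real s) = exp (- 2 * of_real pi * \<i> * of_real s * of_real t)"
        by (simp add: E_def exp_of_real[symmetric] exp_add[symmetric] mult_ac)
      then show "A s * of_real (exp (- pi * s\<^sup>2)) * E (of_real s) = A s * exp (- 2 * of_real pi * \<i> * of_real s * of_real t)"
        by (simp only: mult.assoc)
    qed
    finally show ?thesis .
  qed
  have "(\<lambda>n. c * (e n * m G n)) sums (c * fourier G t)"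
    by (intro sums_mult fourier_sums G)
  moreover have "(\<lambda>n. c * (e n * m G n)) sums fourier F t"
    using fourier_sums[OF F] by (simp add: moments mult_ac)
  ultimately show ?thesis using sums_unique2 by blast
qed

lemma PW_spectrum:
  assumes "1 \<le> p" "f \<in> PW p B"
  obtains F where "integrable lborel F" "\<And>s. s \<notin> {-B..B} \<Longrightarrow> F s = 0"
    "\<And>\<phi>. \<phi> \<in> schwartz \<Longrightarrow> regular_distr f \<phi> = distr_fourier (regular_distr F) \<phi>"
    "\<And>t. f t = fourier F t"
proof -
  obtain F where F: "F \<in> Lp_interval p B"
      and eq: "\<And>\<phi>. \<phi> \<in> schwartz \<Longrightarrow> regular_distr f \<phi> = distr_fourier (regular_distr F) \<phi>"
      and f: "continuous_on UNIV f" "bounded (range f)"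
    using assms(2) by (auto simp: PW_def)
  have int: "integrable lborel F"
    by (rule Lp_interval_integrable[OF assms(1) F])
  show ?thesis
  proof (rule that[OF int _ eq])
    show "F s = 0" if "s \<notin> {-B..B}" for s
      using F that by (auto simp: Lp_interval_def)
    show "f t = fourier F t" for t
      by (rule eq_fourier_if_distr_eq[OF f int eq])
  qed
qed

section \<open>Phase retrieval from Gabor magnitudes\<close>

lemma gabor_mult_left: "gabor (\<lambda>t. c * g t) x \<omega> = c * gabor g x \<omega>"
  unfolding gabor_def by (simp add: mult.assoc)

theorem theorem3p1:
  fixes p :: ennreal and B :: real and X \<Omega> :: "real set" and f g :: "real \<Rightarrow> complex"
  assumes "1 \<le> p" and "B > 0"
    and "uniform_discrete X" and "lower_uniform_density X > 4 * B"
    and "countable \<Omega>" and "\<not> (\<lambda>\<omega>. 1 / \<bar>\<omega>\<bar>) summable_on (\<Omega> - {0})"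
    and "f \<in> PW p B" and "g \<in> PW p B"
  shows "(\<exists>\<alpha>::real. \<forall>t. f t = exp (\<i> * of_real \<alpha>) * g t) \<longleftrightarrow>
         (\<forall>(x, \<omega>) \<in> X \<times> \<Omega>. cmod (gabor f x \<omega>) = cmod (gabor g x \<omega>))"
proof
  assume "\<exists>\<alpha>::real. \<forall>t. f t = exp (\<i> * of_real \<alpha>) * g t"
  then obtain \<alpha> :: real where "f = (\<lambda>t. exp (\<i> * of_real \<alpha>) * g t)"
    by auto
  then show "\<forall>(x, \<omega>) \<in> X \<times> \<Omega>. cmod (gabor f x \<omega>) = cmod (gabor g x \<omega>)"
    by (simp add: gabor_mult_left norm_mult)
next
  assume grid: "\<forall>(x, \<omega>) \<in> X \<times> \<Omega>. cmod (gabor f x \<omega>) = cmod (gabor g x \<omega>)"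
  obtain F where F: "integrable lborel F" "\<And>s. s \<notin> {-B..B} \<Longrightarrow> F s = 0"
      "\<And>\<phi>. \<phi> \<in> schwartz \<Longrightarrow> regular_distr f \<phi> = distr_fourier (regular_distr F) \<phi>"
      "\<And>t. f t = fourier F t"
    using PW_spectrum[OF assms(1,7)] by metis
  obtain G where G: "integrable lborel G" "\<And>s. s \<notin> {-B..B} \<Longrightarrow> G s = 0"
      "\<And>\<phi>. \<phi> \<in> schwartz \<Longrightarrow> regular_distr g \<phi> = distr_fourier (regular_distr G) \<phi>"
      "\<And>t. g t = fourier G t"
    using PW_spectrum[OF assms(1,8)] by metis
  obtain r where r: "r > 0" "4 * B * r < real (min_count X r)"
    using lower_uniform_density_gt_imp_count[OF assms(3,4)] by blast
  obtain e where e: "e > 0" "\<And>x y. x \<in> X \<Longrightarrow> y \<in> X \<Longrightarrow> dist x y < e \<Longrightarrow> x = y"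
    using assms(3) by (auto simp: uniform_discrete_def)
  define C where "C = max (LINT s|lborel. cmod (F s)) (LINT s|lborel. cmod (G s))"
  have bound: "cmod (bargmann F z) \<le> C * exp ((2 * pi * B) * \<bar>Im z\<bar>)"
              "cmod (bargmann G z) \<le> C * exp ((2 * pi * B) * \<bar>Im z\<bar>)" for z
    using norm_bargmann_le[of F B z] norm_bargmann_le[of G B z] F G
    by (auto simp: C_def intro: order_trans[OF _ mult_right_mono])
  have "\<exists>c. cmod c = 1 \<and> (\<forall>z. bargmann F z = c * bargmann G z)"
  proof (rule phase_retrieval_on_grid[OF _ _ _ bound])
    show "bargmann F holomorphic_on UNIV" "bargmann G holomorphic_on UNIV"
      using F G by (auto intro!: bargmann_holomorphic[of _ B])
    show "finite (X \<inter> {a..b})" for a b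
      using separated_interval_count(1)[OF e(2,1), where t = a and r = "b - a"] by simp
    show "min_count X r \<le> card (X \<inter> {t..t + r})" for t
      by (rule min_count_le)
    show "2 * (2 * pi * B) * r < pi * real (min_count X r)"
      using mult_strict_left_mono[OF r(2) pi_gt_zero] by (simp add: mult_ac)
    show "cmod (bargmann F (Complex x (- \<omega>))) = cmod (bargmann G (Complex x (- \<omega>)))"
      if "x \<in> X" "\<omega> \<in> \<Omega>" for x \<omega>
    proof -
      have "cmod (gabor f x \<omega>) = cmod (gabor g x \<omega>)" using grid that by auto
      then show ?thesis
        by (simp add: norm_gabor_eq_norm_bargmann[OF F(3)] norm_gabor_eq_norm_bargmann[OF G(3)])
    qed
  qed (use assms r in auto)
  then obtain c where c: "cmod c = 1" "\<And>z. bargmann F z = c * bargmann G z"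
    by blast
  have fg: "f t = c * g t" for t
    using fourier_eq_if_bargmann_eq[OF F(1,2) G(1,2) c(2)] by (simp add: F(4) G(4))
  obtain \<alpha> where "c = exp (\<i> * of_real \<alpha>)"
    using c(1) complex_norm_eq_1_exp by metis
  then show "\<exists>\<alpha>::real. \<forall>t. f t = exp (\<i> * of_real \<alpha>) * g t"
    using fg by blast
qed

end
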